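(* Let $\nu>-1/2$, $0\le|\beta|<\alpha$, $\mu\in\mathbb{R}$ and let $X\sim\mathrm{VG}(\nu,\alpha,\beta,\mu)$. Then, for every odd integer $r\ge1$, $$\begin{aligned} \mathbb{E}[|X|^r]&=\frac{2^r(1-\beta^2/\alpha^2)^{\nu+1/2}}{\sqrt{\pi}\alpha^{r}\Gamma(\nu+1/2)}\bigg\{\sum_{k=0}^{(r-1)/2}\Big(\frac{\alpha\mu}{2}\Big)^{2k}\Gamma\Big(\frac{r-2k+1}{2}\Big)\Gamma\Big(\nu+\frac{r-2k+1}{2}\Big)\\ &\quad\times\bigg[\binom{r}{2k}\,{}_2F_1\Big(\frac{r-2k+1}{2},\nu+\frac{r-2k+1}{2};\frac12;\frac{\beta^2}{\alpha^2}\Big)+\beta\mu\binom{r}{2k+1}\,{}_2F_1\Big(\frac{r-2k+1}{2},\nu+\frac{r-2k+1}{2};\frac32;\frac{\beta^2}{\alpha^2}\Big)\bigg]\\ &\quad-\sum_{k=0}^{r}\binom{r}{k}(-1)^k\Big(\frac{\alpha|\mu|}{2}\Big)^k\sum_{j=0}^\infty\frac{(-2\,\mathrm{sgn}(\mu)\beta/\alpha)^j}{j!}\Gamma\Big(\frac{r+j-k+1}{2}\Big)\Gamma\Big(\nu+\frac{r+j-k+1}{2}\Big)G_{\nu+r+j-k,\nu}(\alpha|\mu|)\bigg\}. \end{aligned}$$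
   Context: $\mathrm{VG}(\nu,\alpha,\beta,\mu)$ denotes the variance-gamma distribution, with probability density function on $\mathbb{R}$ $$p(x)=\frac{(\alpha^2-\beta^2)^{\nu+1/2}}{\sqrt{\pi}(2\alpha)^\nu\Gamma(\nu+1/2)}\,\mathrm{e}^{\beta(x-\mu)}|x-\mu|^\nu K_\nu(\alpha|x-\mu|),$$ where $K_\nu$ is the modified Bessel function of the second kind. ${}_2F_1$ and ${}_1F_2$ are (generalized) hypergeometric functions, and $\mathrm{sgn}$ is the sign function with $\mathrm{sgn}(0)=0$. Convention: $0^0=1$. For $a\ge\nu>-1/2$ and $x>0$, $$G_{a,\nu}(x)=x\big(K_\nu(x)\,\tilde t_{a-1,\nu-1}(x)+K_{\nu-1}(x)\,\tilde t_{a,\nu}(x)\big),\qquad G_{a,\nu}(0)=0,$$ where $\tilde t_{a,\nu}$ is the normalised modified Lommel function of the first kind $$\tilde t_{a,\nu}(x)=\frac{x^{a+1}}{2^{a+1}\Gamma((a-\nu+3)/2)\Gamma((a+\nu+3)/2)}\,{}_1F_2\Big(1;\frac{a-\nu+3}{2},\frac{a+\nu+3}{2};\frac{x^2}{4}\Big).$$ *)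

theory Defs
  imports "HOL-Probability.Probability"
begin

text \<open>
  Modified Bessel function of the second kind of real order, defined for positive argument by
  $K_\nu(x) = \int_0^\infty \mathrm{e}^{-x\cosh t}\cosh(\nu t)\,\mathrm{d}t$. At nonpositive
  arguments the integral diverges and the value carries no meaning.
\<close>
definition bessel_K :: "real \<Rightarrow> real \<Rightarrow> real" where
  "bessel_K \<nu> x = (LBINT t:{0..}. exp (- x * cosh t) * cosh (\<nu> * t))"

definition hyper_2F1 :: "real \<Rightarrow> real \<Rightarrow> real \<Rightarrow> real \<Rightarrow> real" where
  "hyper_2F1 a b c z = eval_fps (fps_hypergeo [a, b] [c] 1) z"

definition hyper_1F2 :: "real \<Rightarrow> real \<Rightarrow> real \<Rightarrow> real \<Rightarrow> real" where
  "hyper_1F2 a b c z = eval_fps (fps_hypergeo [a] [b, c] 1) z"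

definition normalised_lommel_t :: "real \<Rightarrow> real \<Rightarrow> real \<Rightarrow> real" where
  "normalised_lommel_t a \<nu> x =
     x powr (a + 1) / (2 powr (a + 1) * Gamma ((a - \<nu> + 3) / 2) * Gamma ((a + \<nu> + 3) / 2))
     * hyper_1F2 1 ((a - \<nu> + 3) / 2) ((a + \<nu> + 3) / 2) (x\<^sup>2 / 4)"

definition lommel_G :: "real \<Rightarrow> real \<Rightarrow> real \<Rightarrow> real" where
  "lommel_G a \<nu> x =
     (if x = 0 then 0
      else x * (bessel_K \<nu> x * normalised_lommel_t (a - 1) (\<nu> - 1) x + bessel_K (\<nu> - 1) x * normalised_lommel_t a \<nu> x))"

text \<open>
  Variance-gamma density. Its value at the single point \<open>x = \<mu>\<close>, where the formula may be
  singular, is immaterial.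
\<close>
definition vg_density :: "real \<Rightarrow> real \<Rightarrow> real \<Rightarrow> real \<Rightarrow> real \<Rightarrow> real" where
  "vg_density \<nu> \<alpha> \<beta> \<mu> x =
     (\<alpha>\<^sup>2 - \<beta>\<^sup>2) powr (\<nu> + 1/2) / (sqrt pi * (2 * \<alpha>) powr \<nu> * Gamma (\<nu> + 1/2))
     * exp (\<beta> * (x - \<mu>)) * \<bar>x - \<mu>\<bar> powr \<nu> * bessel_K \<nu> (\<alpha> * \<bar>x - \<mu>\<bar>)"

end

theory Submission
  imports Defs
begin

text \<open>
  After centring at \<open>\<mu>\<close> and folding the real line at the origin, the moment becomes an integral over
  \<open>y > 0\<close> of \<open>((m + y)^r exp (b y) + \<bar>m - y\<bar>^r exp (- b y)) y^\<nu> K\<^sub>\<nu>(\<alpha> y)\<close> with \<open>m = \<bar>\<mu>\<bar>\<close> and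
  \<open>b = sgn \<mu> \<beta>\<close>. As \<open>r\<close> is odd, \<open>\<bar>m - y\<bar>^r\<close> is \<open>- (m - y)^r\<close>, corrected by \<open>2 (m - y)^r\<close> on \<open>y < m\<close>.
  Binomial expansion of the first contribution leaves integrals of \<open>cosh (b y)\<close> and \<open>sinh (b y)\<close> against
  \<open>y^(n + \<nu>) K\<^sub>\<nu>(\<alpha> y)\<close>; expanding these in powers of \<open>y\<close> and using the Mellin transform of \<open>K\<^sub>\<nu>\<close> (Fubini and the
  Beta integral) gives the \<open>2F1\<close> terms. The correction is treated in the same way with the exponential
  series and the incomplete Mellin transform over \<open>(0, m)\<close>, which \<open>G\<close> evaluates since its derivative is a multiple of
  \<open>x^a K\<^sub>\<nu>(x)\<close> and it vanishes at \<open>0\<close>.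
\<close>

subsection \<open>Modified Bessel functions of the second kind\<close>

text \<open>\<open>bessel_K\<close> is given only as an integral, so its differentiability, its
  recurrence and its size near 0 all have to come from the integrand; the single estimate
  \<open>bessel_K_kernel_le\<close> serves integrability, boundary terms and growth. The origin of
  \<open>lommel_G\<close> is a Wronskian: it is \<open>x (K t' - K' t)\<close> for
  \<open>K = bessel_K \<nu>\<close> and \<open>t = normalised_lommel_t a \<nu>\<close>, with the
  derivatives eliminated by first-order relations. Since t solves the modified Bessel equation up to
  a forcing term that is a power of x, differentiation cancels the homogeneous parts and leaves that
  power times K. The sign chosen for the reflected half is what makes the main part summable in
  closed form: each binomial term then carries a pure cosh or a pure sinh, the powers of y advance
  in steps of two, and under such steps the Gamma factors change by Pochhammer symbols. In the
  correction the value of G changes with every power of y, so that part stays a series.\<close>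

lemma exp_minus_le_powr:
  fixes z c :: real
  assumes "z > 0" "c > 0"
  shows "exp (- z) \<le> (c / z) powr c"
proof -
  have "ln (z / c) \<le> z / c - 1" using assms by (intro ln_le_minus_one) auto
  hence "c * ln (z / c) \<le> z - c" using assms by (simp add: field_simps)
  hence "- z \<le> c * ln (c / z)" using assms by (simp add: ln_div algebra_simps)
  thus ?thesis using assms by (simp add: powr_def)
qed

lemma exp_le_2_cosh: "exp u \<le> 2 * cosh (u::real)"
  by (simp add: cosh_def)

lemma cosh_le_exp_abs: "cosh (x::real) \<le> exp \<bar>x\<bar>"
  by (cases "x \<ge> 0") (auto simp: cosh_def)

text \<open>From \<open>2 cosh u \<ge> exp u\<close> the kernel decays doubly exponentially in u.
  \<open>exp_minus_le_powr\<close> trades this for a plain exponential with a free rate c: any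
  \<open>c > \<bar>\<nu>\<bar>\<close> makes the bound integrable, and c is also the order of growth
  allowed as x tends to 0.\<close>

lemma bessel_K_kernel_le:
  fixes c x \<nu> u :: real
  assumes "c > 0" "x > 0" "u \<ge> 0"
  shows "exp (- x * cosh u) * cosh (\<nu> * u) \<le> (2 * c / x) powr c * exp (- (c - \<bar>\<nu>\<bar>) * u)"
proof -
  have "exp (- x * cosh u) \<le> exp (- (x * exp u / 2))"
    using exp_le_2_cosh[of u] assms by (auto simp: field_simps)
  also have "\<dots> \<le> (c / (x * exp u / 2)) powr c"
    using assms by (intro exp_minus_le_powr) auto
  also have "\<dots> = ((2 * c / x) * exp (-u)) powr c"
    by (simp add: exp_minus field_simps)
  also have "\<dots> = (2 * c / x) powr c * exp (- (c * u))"
    using assms by (subst powr_mult) (auto simp: powr_def)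
  finally have 1: "exp (- x * cosh u) \<le> (2 * c / x) powr c * exp (- (c * u))" .
  have 2: "cosh (\<nu> * u) \<le> exp (\<bar>\<nu>\<bar> * u)"
    using cosh_le_exp_abs[of "\<nu> * u"] assms by (simp add: abs_mult)
  have "exp (- x * cosh u) * cosh (\<nu> * u) \<le> ((2 * c / x) powr c * exp (- (c * u))) * exp (\<bar>\<nu>\<bar> * u)"
    using 1 2 by (intro mult_mono) auto
  also have "\<dots> = (2 * c / x) powr c * exp (- (c - \<bar>\<nu>\<bar>) * u)"
    by (simp add: mult.assoc flip: exp_add) (simp add: algebra_simps)
  finally show ?thesis .
qed

text \<open>A bridge from gauge integrals to Lebesgue integrals: nonnegativity makes the convergence
  absolute, and Borel measurability passes from the completed measure down to
  \<open>lborel\<close>.\<close>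

lemma has_integral_nonneg_imp_lborel:
  fixes f :: "real \<Rightarrow> real"
  assumes int: "(f has_integral I) S" and meas: "set_borel_measurable lborel S f"
    and nonneg: "\<And>x. x \<in> S \<Longrightarrow> f x \<ge> 0"
  shows "set_integrable lborel S f" "(LBINT x:S. f x) = I"
proof -
  have "f absolutely_integrable_on S"
    using int nonneg by (intro nonnegative_absolutely_integrable_1) auto
  thus *: "set_integrable lborel S f"
    using meas by (simp add: set_integrable_def set_borel_measurable_def integrable_completion)
  show "(LBINT x:S. f x) = I"
    using set_borel_integral_eq_integral(2)[OF *] int by (simp add: integral_unique)
qed

lemma set_integral_atLeast_eq_greaterThan:
  fixes f :: "real \<Rightarrow> real"
  shows "set_integrable lborel {a..} f \<longleftrightarrow> set_integrable lborel {a<..} f"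
    and "(LBINT x:{a..}. f x) = (LBINT x:{a<..}. f x)"
proof -
  have *: "(\<lambda>x. indicator {a..} x *\<^sub>R f x) = (\<lambda>x. indicator {a<..} x *\<^sub>R f x + indicator {a} x * f a)"
    by (auto split: split_indicator)
  have **: "integrable lborel (\<lambda>x. indicator {a} x * f a)" by simp
  show int: "set_integrable lborel {a..} f \<longleftrightarrow> set_integrable lborel {a<..} f"
    unfolding set_integrable_def * using **
    by (metis (no_types, lifting) Bochner_Integration.integrable_add Bochner_Integration.integrable_cong Bochner_Integration.integrable_diff add_diff_cancel_right')
  show "(LBINT x:{a..}. f x) = (LBINT x:{a<..}. f x)"
  proof (cases "set_integrable lborel {a<..} f")
    case True
    hence "integrable lborel (\<lambda>x. indicator {a<..} x *\<^sub>R f x)"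
      by (simp add: set_integrable_def)
    thus ?thesis unfolding set_lebesgue_integral_def *
      by (subst Bochner_Integration.integral_add[OF _ **]) auto
  next
    \<comment> \<open>Both sides are then the default value 0 of a non-integrable integrand.\<close>
    case False
    thus ?thesis using int
      by (simp add: set_integrable_def set_lebesgue_integral_def not_integrable_integral_eq)
  qed
qed

lemma set_integral_exp_minus:
  fixes d :: real
  assumes "d > 0"
  shows "set_integrable lborel {0..} (\<lambda>u. exp (- d * u))" "(LBINT u:{0..}. exp (- d * u)) = 1 / d"
proof -
  have *: "((\<lambda>u. exp (- d * u)) has_integral (exp (- d * 0) / d)) {0..}"
    by (rule has_integral_exp_minus_to_infinity[OF assms])
  show "set_integrable lborel {0..} (\<lambda>u. exp (- d * u))" "(LBINT u:{0..}. exp (- d * u)) = 1 / d"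
    using has_integral_nonneg_imp_lborel[OF *] by (simp_all add: set_borel_measurable_def)
qed

lemma set_integrable_bessel_K:
  fixes \<nu> x :: real
  assumes "x > 0"
  shows "set_integrable lborel {0..} (\<lambda>u. exp (- x * cosh u) * cosh (\<nu> * u))"
proof (rule set_integrable_bound)
  \<comment> \<open>The choice \<open>c = \<bar>\<nu>\<bar> + 1\<close> in the kernel bound leaves
    decay rate exactly 1.\<close>
  show "set_integrable lborel {0..} (\<lambda>u. (2 * (\<bar>\<nu>\<bar> + 1) / x) powr (\<bar>\<nu>\<bar> + 1) * exp (- 1 * u))"
    by (intro set_integrable_mult_right impI set_integral_exp_minus) auto
  show "set_borel_measurable lborel {0..} (\<lambda>u. exp (- x * cosh u) * cosh (\<nu> * u))"
    unfolding set_borel_measurable_def cosh_def by measurable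
  show "AE u in lborel. u \<in> {0..} \<longrightarrow> norm (exp (- x * cosh u) * cosh (\<nu> * u)) \<le> 
     norm ((2 * (\<bar>\<nu>\<bar> + 1) / x) powr (\<bar>\<nu>\<bar> + 1) * exp (- 1 * u))"
    using bessel_K_kernel_le[of "\<bar>\<nu>\<bar> + 1" x _ \<nu>] assms by auto
qed

lemma bessel_K_nonneg: "bessel_K \<nu> x \<ge> 0"
  unfolding bessel_K_def set_lebesgue_integral_def by (intro integral_nonneg_AE) auto

lemma bessel_K_le:
  assumes "x > 0" "c > \<bar>\<nu>\<bar>"
  shows "bessel_K \<nu> x \<le> (2 * c / x) powr c / (c - \<bar>\<nu>\<bar>)"
proof -
  have "bessel_K \<nu> x \<le> (LBINT u:{0..}. (2 * c / x) powr c * exp (- (c - \<bar>\<nu>\<bar>) * u))"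
    unfolding bessel_K_def
    by (intro set_integral_mono set_integrable_bessel_K set_integrable_mult_right impI
          set_integral_exp_minus bessel_K_kernel_le) (use assms in auto)
  also have "\<dots> = (2 * c / x) powr c / (c - \<bar>\<nu>\<bar>)"
    by (subst set_integral_mult_right, subst set_integral_exp_minus) (use assms in auto)
  finally show ?thesis .
qed

text \<open>The mean value theorem bounds every difference quotient by the same w that bounds the
  derivative, so dominated convergence applies along each sequence tending to x.\<close>

lemma has_field_derivative_integral_dominated:
  fixes f f' :: "real \<Rightarrow> 'a \<Rightarrow> real"
  assumes int: "\<And>x. x \<in> {a<..<b} \<Longrightarrow> integrable M (f x)"
    and der: "\<And>x t. x \<in> {a<..<b} \<Longrightarrow> t \<in> space M \<Longrightarrow> ((\<lambda>x. f x t) has_real_derivative f' x t) (at x)"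
    and bound: "\<And>x t. x \<in> {a<..<b} \<Longrightarrow> t \<in> space M \<Longrightarrow> \<bar>f' x t\<bar> \<le> w t"
    and w: "integrable M w"
    and meas: "f' x \<in> borel_measurable M"
    and x: "x \<in> {a<..<b}"
  shows "((\<lambda>x. \<integral>t. f x t \<partial>M) has_real_derivative (\<integral>t. f' x t \<partial>M)) (at x)"
  unfolding has_field_derivative_iff
proof (rule tendsto_at_iff_sequentially[THEN iffD2], intro allI impI, unfold o_def)
  fix X :: "nat \<Rightarrow> real"
  assume X: "\<forall>i. X i \<in> UNIV - {x}" "X \<longlonglongrightarrow> x"
  have ev: "eventually (\<lambda>n. X n \<in> {a<..<b}) sequentially"
    using X(2) x by (intro topological_tendstoD) auto
  then obtain N where N: "\<And>n. n \<ge> N \<Longrightarrow> X n \<in> {a<..<b}"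
    by (auto simp: eventually_sequentially)
  \<comment> \<open>The domination must hold for every index, so the finitely many terms possibly
    outside the interval are dropped.\<close>
  define Y where "Y n = X (n + N)" for n
  have Y: "Y n \<in> {a<..<b}" "Y n \<noteq> x" for n using N[of "n + N"] X(1) by (auto simp: Y_def)
  have Ylim: "Y \<longlonglongrightarrow> x" unfolding Y_def using X(2) by (rule LIMSEQ_ignore_initial_segment)
  have "(\<lambda>n. \<integral>t. (f (Y n) t - f x t) / (Y n - x) \<partial>M) \<longlonglongrightarrow> (\<integral>t. f' x t \<partial>M)"
  proof (rule integral_dominated_convergence[where w = w])
    show "AE t in M. (\<lambda>n. (f (Y n) t - f x t) / (Y n - x)) \<longlonglongrightarrow> f' x t"
    proof (rule AE_I2)
      fix t assume "t \<in> space M"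
      from der[OF x this] have "((\<lambda>y. (f y t - f x t) / (y - x)) \<longlongrightarrow> f' x t) (at x)"
        by (simp add: has_field_derivative_iff)
      thus "(\<lambda>n. (f (Y n) t - f x t) / (Y n - x)) \<longlonglongrightarrow> f' x t"
        by (rule filterlim_compose) (use Y Ylim in \<open>auto simp: filterlim_at\<close>)
    qed
    show "AE t in M. norm ((f (Y n) t - f x t) / (Y n - x)) \<le> w t" for n
    proof (rule AE_I2)
      fix t assume t: "t \<in> space M"
      have "norm (f (Y n) t - f x t) \<le> w t * norm (Y n - x)"
        by (rule field_differentiable_bound[where S = "{a<..<b}" and f' = "\<lambda>x. f' x t"])
           (use Y[of n] x t der bound in \<open>auto intro: has_field_derivative_at_within\<close>)
      thus "norm ((f (Y n) t - f x t) / (Y n - x)) \<le> w t"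
        using Y[of n] by (simp add: field_simps)
    qed
    show "(\<lambda>t. (f (Y n) t - f x t) / (Y n - x)) \<in> borel_measurable M" for n
      using int[OF Y(1)[of n]] int[OF x] by measurable
  qed (use w meas in auto)
  also have "(\<lambda>n. \<integral>t. (f (Y n) t - f x t) / (Y n - x) \<partial>M) =
     (\<lambda>n. ((\<integral>t. f (Y n) t \<partial>M) - (\<integral>t. f x t \<partial>M)) / (Y n - x))"
    using int[OF Y(1)] int[OF x] by (simp add: Bochner_Integration.integral_diff)
  finally show "(\<lambda>n. ((\<integral>t. f (X n) t \<partial>M) - (\<integral>t. f x t \<partial>M)) / (X n - x)) \<longlonglongrightarrow> (\<integral>t. f' x t \<partial>M)"
    unfolding Y_def by (rule LIMSEQ_offset)
qed

lemma cosh_mult_cosh: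
  "cosh (u::real) * cosh (\<nu> * u) = (cosh ((\<nu> + 1) * u) + cosh ((\<nu> - 1) * u)) / 2"
  by (simp add: cosh_add cosh_diff ring_distribs)

lemma has_real_derivative_bessel_K_aux:
  assumes "x > 0"
  shows "(bessel_K \<nu> has_real_derivative (- (bessel_K (\<nu> + 1) x + bessel_K (\<nu> - 1) x) / 2)) (at x)"
proof -
  define k where "k = (\<lambda>\<nu> x u. indicator {0..} u * (exp (- x * cosh u) * cosh (\<nu> * u)) :: real)"
  have K: "bessel_K \<nu> x = (\<integral>u. k \<nu> x u \<partial>lborel)" for \<nu> x
    by (simp add: bessel_K_def k_def set_lebesgue_integral_def)
  have bd: "\<bar>- (a + b) / 2\<bar> \<le> (c + d) / 2" if "0 \<le> a" "a \<le> c" "0 \<le> b" "b \<le> d" for a b c d :: real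
    using that by (auto simp: abs_le_iff field_simps)
  have int: "integrable lborel (k \<nu> x)" if "x > 0" for x \<nu>
    using set_integrable_bessel_K[OF that] by (simp add: k_def set_integrable_def)
  have [measurable]: "k \<nu> x \<in> borel_measurable lborel" for \<nu> x
    unfolding k_def cosh_def by measurable
  have "((\<lambda>x. \<integral>u. k \<nu> x u \<partial>lborel) has_real_derivative 
          (\<integral>u. - (k (\<nu> + 1) x u + k (\<nu> - 1) x u) / 2 \<partial>lborel)) (at x)"
  proof (rule has_field_derivative_integral_dominated
      [where a = "x/2" and b = "2 * x" and w = "\<lambda>u. (k (\<nu> + 1) (x/2) u + k (\<nu> - 1) (x/2) u) / 2"])
    fix y u :: real assume y: "y \<in> {x/2<..<2*x}"
    show "((\<lambda>x. k \<nu> x u) has_real_derivative - (k (\<nu> + 1) y u + k (\<nu> - 1) y u) / 2) (at y)"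
      unfolding k_def
      by (auto intro!: derivative_eq_intros simp: cosh_mult_cosh ring_distribs split: split_indicator)
         (simp add: cosh_add cosh_diff ring_distribs)
    \<comment> \<open>The kernel decreases in its argument, so its value at the left end
      \<open>x/2\<close> dominates it on the whole neighbourhood.\<close>
    have "k \<nu> y u \<le> k \<nu> (x/2) u" for \<nu>
      using y by (auto simp: k_def intro!: mult_right_mono mult_left_mono split: split_indicator)
    moreover have "k \<nu> y u \<ge> 0" for \<nu> by (auto simp: k_def)
    ultimately have "0 \<le> k (\<nu> + 1) y u" "k (\<nu> + 1) y u \<le> k (\<nu> + 1) (x/2) u"
        "0 \<le> k (\<nu> - 1) y u" "k (\<nu> - 1) y u \<le> k (\<nu> - 1) (x/2) u" by blast+
    thus "\<bar>- (k (\<nu> + 1) y u + k (\<nu> - 1) y u) / 2\<bar> \<le> (k (\<nu> + 1) (x/2) u + k (\<nu> - 1) (x/2) u) / 2"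
      by (rule bd)
  qed (use assms in \<open>auto intro!: int Bochner_Integration.integrable_add integrable_divide\<close>)
  also have "(\<integral>u. - (k (\<nu> + 1) x u + k (\<nu> - 1) x u) / 2 \<partial>lborel) = - (bessel_K (\<nu> + 1) x + bessel_K (\<nu> - 1) x) / 2"
    using int[OF assms] by (simp add: K)
  finally show ?thesis by (simp flip: K)
qed

text \<open>An integration by parts: f is the derivative of
  \<open>exp (- x * cosh u) * sinh (\<nu> * u)\<close>, which vanishes at 0 because of sinh and at
  infinity by the kernel bound, so f integrates to 0 over the half-line.\<close>

lemma bessel_K_recurrence:
  assumes "x > 0"
  shows "\<nu> * bessel_K \<nu> x = x * (bessel_K (\<nu> + 1) x - bessel_K (\<nu> - 1) x) / 2"
proof -
  define F where "F u = exp (- x * cosh u) * sinh (\<nu> * u)" for u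
  define k where "k = (\<lambda>\<nu> u. exp (- x * cosh u) * cosh (\<nu> * u) :: real)"
  define f where "f u = \<nu> * k \<nu> u - x / 2 * (k (\<nu> + 1) u - k (\<nu> - 1) u)" for u
  have K: "bessel_K \<nu> x = (LBINT u:{0..}. k \<nu> u)" for \<nu>
    by (simp add: bessel_K_def k_def)
  have int: "set_integrable lborel {0..} (k \<nu>)" for \<nu>
    using set_integrable_bessel_K[OF assms] by (simp add: k_def)
  have f: "set_integrable lborel {0..} f"
    unfolding f_def by (intro set_integral_diff set_integrable_mult_right impI int)
  have F: "(F has_real_derivative f u) (at u)" for u
    unfolding F_def f_def k_def
    by (auto intro!: derivative_eq_intros) (simp add: cosh_add cosh_diff field_simps)
  have lim: "(F \<longlongrightarrow> 0) at_top"
  proof (rule Lim_null_comparison)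
    let ?c = "\<bar>\<nu>\<bar> + 1"
    show "eventually (\<lambda>u. norm (F u) \<le> (2 * ?c / x) powr ?c * exp (- u)) at_top"
      using eventually_ge_at_top[of 0]
    proof eventually_elim
      case (elim u)
      have "\<bar>sinh (\<nu> * u)\<bar> \<le> cosh (\<nu> * u)"
        by (metis abs_le_iff cosh_minus less_imp_le sinh_le_cosh_real sinh_minus)
      hence "norm (F u) \<le> exp (- x * cosh u) * cosh (\<nu> * u)"
        by (auto simp: F_def abs_mult)
      also have "\<dots> \<le> (2 * ?c / x) powr ?c * exp (- (?c - \<bar>\<nu>\<bar>) * u)"
        by (rule bessel_K_kernel_le) (use assms elim in auto)
      finally show ?case by simp
    qed
    show "((\<lambda>u. (2 * ?c / x) powr ?c * exp (- u)) \<longlongrightarrow> 0) at_top"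
      by (intro tendsto_mult_right_zero filterlim_compose[OF exp_at_bot] filterlim_uminus_at_bot_at_top)
  qed
  have "(LBINT u=0..\<infinity>. f u) = 0 - 0"
  proof (rule interval_integral_FTC_integrable)
    show "(F has_vector_derivative f u) (at u)" for u
      using F by (simp add: has_real_derivative_iff_has_vector_derivative)
    show "isCont f u" for u unfolding f_def k_def by (intro continuous_intros)
    show "set_integrable lborel (einterval 0 \<infinity>) f"
      by (rule set_integrable_subset[OF f]) (auto simp: einterval_def)
    have "isCont F 0" using F by (rule DERIV_isCont)
    hence "(F \<longlongrightarrow> 0) (at_right 0)" by (simp add: F_def isCont_def filterlim_at_split)
    thus "((F \<circ> real_of_ereal) \<longlongrightarrow> 0) (at_right 0)"
      by (simp add: ereal_tendsto_simps1 zero_ereal_def)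
    show "((F \<circ> real_of_ereal) \<longlongrightarrow> 0) (at_left \<infinity>)"
      using lim by (simp add: ereal_tendsto_simps1)
  qed auto
  hence "0 = (LBINT u:{0..}. f u)"
    by (simp add: interval_lebesgue_integral_0_infty set_integral_atLeast_eq_greaterThan)
  also have "\<dots> = \<nu> * bessel_K \<nu> x - x / 2 * (bessel_K (\<nu> + 1) x - bessel_K (\<nu> - 1) x)"
    unfolding f_def K by (simp add: int set_integral_diff)
  finally show ?thesis by (simp add: field_simps)
qed

text \<open>Two forms are kept so that the derivative of \<open>lommel_G\<close> involves no orders
  beyond \<nu> and \<nu> - 1: the first is applied at order \<nu>, the second at order \<nu> -
  1.\<close>

lemma has_real_derivative_bessel_K:
  assumes "x > 0"
  shows "(bessel_K \<nu> has_real_derivative (- bessel_K (\<nu> - 1) x - \<nu> / x * bessel_K \<nu> x)) (at x)"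
    and "(bessel_K \<nu> has_real_derivative (\<nu> / x * bessel_K \<nu> x - bessel_K (\<nu> + 1) x)) (at x)"
proof -
  have r: "\<nu> / x * bessel_K \<nu> x = (bessel_K (\<nu> + 1) x - bessel_K (\<nu> - 1) x) / 2"
    using bessel_K_recurrence[OF assms, of \<nu>] assms by (simp add: field_simps)
  have 1: "- (bessel_K (\<nu> + 1) x + bessel_K (\<nu> - 1) x) / 2 = - bessel_K (\<nu> - 1) x - \<nu> / x * bessel_K \<nu> x"
    unfolding r by (simp add: field_simps)
  have 2: "- (bessel_K (\<nu> + 1) x + bessel_K (\<nu> - 1) x) / 2 = \<nu> / x * bessel_K \<nu> x - bessel_K (\<nu> + 1) x"
    unfolding r by (simp add: field_simps)
  show "(bessel_K \<nu> has_real_derivative (- bessel_K (\<nu> - 1) x - \<nu> / x * bessel_K \<nu> x)) (at x)"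
    using has_real_derivative_bessel_K_aux[OF assms, of \<nu>] unfolding 1 .
  show "(bessel_K \<nu> has_real_derivative (\<nu> / x * bessel_K \<nu> x - bessel_K (\<nu> + 1) x)) (at x)"
    using has_real_derivative_bessel_K_aux[OF assms, of \<nu>] unfolding 2 .
qed

subsection \<open>Mellin transform\<close>

lemma borel_measurable_cosh [measurable (raw)]:
  fixes f :: "'a \<Rightarrow> real"
  assumes [measurable]: "f \<in> borel_measurable M"
  shows "(\<lambda>x. cosh (f x)) \<in> borel_measurable M"
  unfolding cosh_def by measurable

lemma borel_measurable_bessel_K [measurable (raw)]:
  assumes [measurable]: "f \<in> borel_measurable M"
  shows "(\<lambda>x. bessel_K \<nu> (f x)) \<in> borel_measurable M"
proof -
  have "bessel_K \<nu> \<in> borel_measurable borel"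
    unfolding bessel_K_def[abs_def] set_lebesgue_integral_def by measurable
  from measurable_compose[OF assms this] show ?thesis .
qed

lemma integral_lborel_fold:
  fixes f :: "real \<Rightarrow> real"
  assumes 1: "set_integrable lborel {0<..} f" and 2: "set_integrable lborel {0<..} (\<lambda>x. f (- x))"
  shows "integrable lborel f" "integral\<^sup>L lborel f = (LBINT x:{0<..}. f x + f (- x))"
proof -
  have 3: "set_integrable lborel {..<0} f"
  proof -
    have "integrable lborel (\<lambda>x. indicator {0<..} x * f (- x))" using 2 by (simp add: set_integrable_def)
    hence "integrable lborel (\<lambda>x. indicator {0<..} (0 + (-1) * x) * f (- (0 + (-1) * x)))"
      by (rule lborel_integrable_real_affine) auto
    also have "(\<lambda>x. indicator {0<..} (0 + (-1) * x) * f (- (0 + (-1) * x))) = (\<lambda>x. indicator {..<0} x * f x)"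
      by (auto split: split_indicator)
    finally show ?thesis by (simp add: set_integrable_def)
  qed
  have 4: "(LBINT x:{..<0}. f x) = (LBINT x:{0<..}. f (- x))"
    using set_integral_reflect[of "{0<..}" "\<lambda>x. f (- x)"] by (simp add: lessThan_def)
  have *: "f = (\<lambda>x. (indicator {0<..} x *\<^sub>R f x + indicator {..<0} x *\<^sub>R f x) + indicator {0} x * f 0)"
    by (auto split: split_indicator)
  have 5: "integrable lborel (\<lambda>x. indicator {0<..} x *\<^sub>R f x)" "integrable lborel (\<lambda>x. indicator {..<0} x *\<^sub>R f x)"
      "integrable lborel (\<lambda>x. indicator {0} x * f 0)"
    using 1 3 by (auto simp: set_integrable_def)
  show "integrable lborel f"
    by (subst *) (intro Bochner_Integration.integrable_add 5)
  have "integral\<^sup>L lborel f = (LBINT x:{0<..}. f x) + (LBINT x:{..<0}. f x)"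
    unfolding set_lebesgue_integral_def
    by (subst *, subst Bochner_Integration.integral_add, intro Bochner_Integration.integrable_add 5, rule 5,
        subst Bochner_Integration.integral_add, rule 5, rule 5) simp
  also have "\<dots> = (LBINT x:{0<..}. f x + f (- x))"
    unfolding 4 using 1 2 by simp
  finally show "integral\<^sup>L lborel f = (LBINT x:{0<..}. f x + f (- x))" .
qed

text \<open>This is the integral in u that remains in the Mellin transform after y has been
  integrated out. Replacing \<open>cosh (\<nu> * u)\<close> by \<open>exp (\<nu> * u)\<close>
  spreads it over the whole line, where it is an honest Beta integral; folding at 0 then restores
  cosh.\<close>

lemma set_integral_cosh_mult_cosh_powr:
  fixes \<nu> s :: real
  assumes "s > \<bar>\<nu>\<bar>"
  shows "set_integrable lborel {0<..} (\<lambda>u. cosh (\<nu> * u) * cosh u powr (- s))"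
    and "(LBINT u:{0<..}. cosh (\<nu> * u) * cosh u powr (- s)) = 2 powr (s - 2) * Beta ((s - \<nu>) / 2) ((s + \<nu>) / 2)"
proof -
  define p q where "p = (s + \<nu>) / 2" and "q = (s - \<nu>) / 2"
  have pq: "p > 0" "q > 0" "p + q = s" "p - q = \<nu>" using assms by (auto simp: p_def q_def field_simps)
  \<comment> \<open>The substitution \<open>t = exp u / (2 cosh u)\<close> maps the real line onto the domain of the Beta integral.\<close>
  define g g' :: "real \<Rightarrow> real" where "g u = exp u / (2 * cosh u)" and "g' u = 2 / (2 * cosh u)\<^sup>2" for u
  define f where "f t = t powr (p - 1) * (1 - t) powr (q - 1)" for t :: real
  define F where "F u = 2 * exp (\<nu> * u) * (2 * cosh u) powr (- s)" for u
  have one_minus_g: "1 - g u = exp (- u) / (2 * cosh u)" for u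
    by (simp add: g_def field_simps) (simp add: cosh_def)
  have F: "\<bar>g' u\<bar> * f (g u) = F u" for u
  proof -
    define c where "c = 2 * cosh u"
    have c: "c > 0" by (simp add: c_def)
    have "c\<^sup>2 = exp (2 * ln c)" using c by (simp add: exp_double)
    hence 1: "\<bar>g' u\<bar> = 2 * exp (- 2 * ln c)"
      unfolding g'_def c_def [symmetric] by (simp add: exp_minus divide_simps)
    have 2: "g u powr (p - 1) = exp ((p - 1) * (u - ln c))"
      using c unfolding g_def c_def [symmetric] by (simp add: powr_def ln_div)
    have 3: "(1 - g u) powr (q - 1) = exp ((q - 1) * (- u - ln c))"
      using c unfolding one_minus_g c_def [symmetric] by (simp add: powr_def ln_div)
    have "\<bar>g' u\<bar> * f (g u) = 2 * (exp (- 2 * ln c) * exp ((p - 1) * (u - ln c)) * exp ((q - 1) * (- u - ln c)))"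
      unfolding f_def 1 2 3 by simp
    also have "\<dots> = 2 * (exp (\<nu> * u) * exp (- s * ln c))"
      unfolding exp_add [symmetric] pq(3,4)[symmetric] by (simp add: algebra_simps)
    also have "\<dots> = F u" using c by (simp add: F_def c_def powr_def)
    finally show ?thesis .
  qed
  have deriv: "(g has_real_derivative g' u) (at u within UNIV)" for u
  proof -
    have "(g has_real_derivative (exp u * (2 * cosh u) - exp u * (2 * sinh u)) / (2 * cosh u * (2 * cosh u))) (at u)"
      unfolding g_def by (auto intro!: derivative_eq_intros)
    also have "exp u * (2 * cosh u) - exp u * (2 * sinh u) = 2"
      by (simp add: cosh_def sinh_def field_simps flip: exp_add)
    finally show ?thesis by (simp add: g'_def power2_eq_square)
  qed
  have inj: "inj g"
  proof (rule strict_mono_imp_inj_on, rule strict_monoI)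
    fix x y :: real assume "x < y"
    thus "g x < g y"
      by (rule DERIV_pos_imp_increasing) (use deriv in \<open>auto simp: g'_def intro!: exI[of _ "g' _"]\<close>)
  qed
  have range: "range g = {0<..<1}"
  proof safe
    fix u show "g u \<in> {0<..<1}" by (simp add: g_def) (simp add: cosh_def)
  next
    fix t :: real assume t: "t \<in> {0<..<1}"
    define u where "u = ln (t / (1 - t)) / 2"
    have e: "exp u * exp u = t / (1 - t)"
      using t by (simp add: u_def flip: exp_add)
    have "2 * cosh u = (exp u * exp u + 1) / exp u"
      by (simp add: cosh_def exp_minus field_simps)
    hence "g u = exp u * exp u / (exp u * exp u + 1)"
      by (simp add: g_def)
    also have "\<dots> = t" unfolding e using t by (simp add: field_simps)
    finally show "t \<in> range g" by auto
  qed
  have Beta: "(f has_integral Beta p q) {0..1}"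
    unfolding f_def by (rule has_integral_Beta_real) (use pq in auto)
  hence Beta': "(f has_integral Beta p q) {0<..<1}"
    by (simp add: has_integral_Icc_iff_Ioo)
  have "f absolutely_integrable_on {0<..<1}"
    using Beta' by (intro nonnegative_absolutely_integrable_1) (auto simp: f_def)
  hence "f absolutely_integrable_on g ` UNIV \<and> integral (g ` UNIV) f = Beta p q"
    using Beta' unfolding range by (simp add: integral_unique)
  hence "(\<lambda>u. \<bar>g' u\<bar> * f (g u)) absolutely_integrable_on UNIV \<and> integral UNIV (\<lambda>u. \<bar>g' u\<bar> * f (g u)) = Beta p q"
    using has_absolute_integral_change_of_variables_1'[of UNIV g g' f "Beta p q"] deriv inj by simp
  hence "F absolutely_integrable_on UNIV" "integral UNIV F = Beta p q" unfolding F by auto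
  hence "(F has_integral Beta p q) UNIV"
    by (metis has_integral_integrable_integral set_lebesgue_integral_eq_integral(1))
  hence F_int: "set_integrable lborel UNIV F" "(LBINT u:UNIV. F u) = Beta p q"
    by (rule has_integral_nonneg_imp_lborel; simp add: F_def set_borel_measurable_def)+
  have F_int': "set_integrable lborel {0<..} F" "set_integrable lborel {0<..} (\<lambda>u. F (- u))"
    using F_int(1) lborel_integrable_real_affine[of F "-1" 0]
    by (auto simp: set_integrable_def intro!: integrable_mult_indicator[where 'b = real, simplified])
  have eq: "F u + F (- u) = 2 powr (2 - s) * (cosh (\<nu> * u) * cosh u powr (- s))" for u
  proof -
    have "F u + F (- u) = 4 * cosh (\<nu> * u) * (2 powr (- s) * cosh u powr (- s))"
      by (simp add: F_def powr_mult cosh_def[of "\<nu> * u"] algebra_simps)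
    also have "2 powr (- s) = 2 powr (2 - s) / (4::real)" by (simp add: powr_diff powr_minus field_simps)
    finally show ?thesis by simp
  qed
  have "set_integrable lborel {0<..} (\<lambda>u. F u + F (- u))"
    using F_int' by (rule set_integral_add)
  thus "set_integrable lborel {0<..} (\<lambda>u. cosh (\<nu> * u) * cosh u powr (- s))"
    unfolding eq by (subst (asm) set_integrable_mult_right_iff) auto
  have "Beta p q = (LBINT u:{0<..}. F u + F (- u))"
    using F_int(2) integral_lborel_fold(2)[OF F_int'] by (simp add: set_lebesgue_integral_def)
  also have "\<dots> = 2 powr (2 - s) * (LBINT u:{0<..}. cosh (\<nu> * u) * cosh u powr (- s))"
    unfolding eq by simp
  finally show "(LBINT u:{0<..}. cosh (\<nu> * u) * cosh u powr (- s)) = 2 powr (s - 2) * Beta ((s - \<nu>) / 2) ((s + \<nu>) / 2)"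
    by (simp add: p_def q_def Beta_commute powr_diff field_simps)
qed

lemma nn_integral_powr_mult_exp_minus:
  fixes c s :: real
  assumes "c > 0" "s > 0"
  shows "(\<integral>\<^sup>+y. ennreal (indicator {0<..} y * (y powr (s - 1) * exp (- c * y))) \<partial>lborel) = ennreal (Gamma s * c powr (- s))"
proof -
  have "(\<integral>\<^sup>+y. ennreal (indicator {0<..} y * (y powr (s - 1) * exp (- c * y))) \<partial>lborel) =
     ennreal \<bar>1 / c\<bar> * (\<integral>\<^sup>+y. ennreal (indicator {0<..} (0 + 1 / c * y) * ((0 + 1 / c * y) powr (s - 1) * exp (- c * (0 + 1 / c * y)))) \<partial>lborel)"
    using assms by (subst nn_integral_real_affine[where t = 0 and c = "1 / c"]) auto
  also have "\<dots> = (\<integral>\<^sup>+y. ennreal (c powr (- s)) * ennreal (indicator {0..} y * y powr (s - 1) / exp y) \<partial>lborel)"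
    using assms
    by (subst nn_integral_cmult [symmetric], force, intro nn_integral_cong)
       (auto simp: powr_divide powr_diff powr_minus exp_minus field_simps zero_less_divide_iff
          simp flip: ennreal_mult'' split: split_indicator)
  also have "\<dots> = ennreal (c powr (- s)) * ennreal (Gamma s)"
    using assms by (subst nn_integral_cmult) (auto simp: Gamma_conv_nn_integral_real)
  also have "\<dots> = ennreal (Gamma s * c powr (- s))"
    using assms by (simp add: mult.commute flip: ennreal_mult'')
  finally show ?thesis .
qed

text \<open>Working with nonnegative integrals allows the exchange of y and u before integrability
  is known, and finiteness of the result supplies it. The integral in y gives
  \<open>Gamma s * (\<alpha> * cosh u) powr (- s)\<close>; its Gamma factor cancels the denominator
  of the Beta function.\<close>

lemma bessel_K_Mellin:
  fixes \<alpha> \<nu> s :: real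
  assumes "\<alpha> > 0" "s > \<bar>\<nu>\<bar>"
  shows "set_integrable lborel {0<..} (\<lambda>y. y powr (s - 1) * bessel_K \<nu> (\<alpha> * y))"
    and "(LBINT y:{0<..}. y powr (s - 1) * bessel_K \<nu> (\<alpha> * y)) =
           2 powr (s - 2) * \<alpha> powr (- s) * Gamma ((s - \<nu>) / 2) * Gamma ((s + \<nu>) / 2)"
proof -
  define R where "R = 2 powr (s - 2) * \<alpha> powr (- s) * Gamma ((s - \<nu>) / 2) * Gamma ((s + \<nu>) / 2)"
  have s: "s > 0" using assms by linarith
  define k where "k y u = indicator {0<..} y * y powr (s - 1) * (indicator {0..} u * (exp (- (\<alpha> * y) * cosh u) * cosh (\<nu> * u)))" for y u :: real
  have [measurable]: "case_prod k \<in> borel_measurable (borel \<Otimes>\<^sub>M borel)"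
    unfolding k_def by measurable
  have "(\<integral>\<^sup>+y. ennreal (indicator {0<..} y * (y powr (s - 1) * bessel_K \<nu> (\<alpha> * y))) \<partial>lborel) =
        (\<integral>\<^sup>+y. (\<integral>\<^sup>+u. ennreal (k y u) \<partial>lborel) \<partial>lborel)"
  proof (intro nn_integral_cong)
    fix y :: real
    show "ennreal (indicator {0<..} y * (y powr (s - 1) * bessel_K \<nu> (\<alpha> * y))) = (\<integral>\<^sup>+u. ennreal (k y u) \<partial>lborel)"
    proof (cases "y > 0")
      case True
      have int: "integrable lborel (k y)" unfolding k_def
        using set_integrable_bessel_K[of "\<alpha> * y" \<nu>] True assms
        by (intro integrable_mult_right) (simp add: set_integrable_def)
      have "(\<integral>\<^sup>+u. ennreal (k y u) \<partial>lborel) = ennreal (\<integral>u. k y u \<partial>lborel)"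
        by (rule nn_integral_eq_integral[OF int]) (auto simp: k_def)
      also have "(\<integral>u. k y u \<partial>lborel) = y powr (s - 1) * bessel_K \<nu> (\<alpha> * y)"
        unfolding k_def bessel_K_def set_lebesgue_integral_def using True
        by (subst integral_mult_right_zero) simp
      finally show ?thesis using True by simp
    qed (auto simp: k_def)
  qed
  also have "\<dots> = (\<integral>\<^sup>+u. (\<integral>\<^sup>+y. ennreal (k y u) \<partial>lborel) \<partial>lborel)"
    by (rule lborel_pair.Fubini') simp
  also have "\<dots> = (\<integral>\<^sup>+u. ennreal (Gamma s * \<alpha> powr (- s)) * ennreal (indicator {0..} u * (cosh (\<nu> * u) * cosh u powr (- s))) \<partial>lborel)"
  proof (intro nn_integral_cong)
    fix u :: real
    have "(\<integral>\<^sup>+y. ennreal (k y u) \<partial>lborel) =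
          (\<integral>\<^sup>+y. ennreal (indicator {0..} u * cosh (\<nu> * u)) * ennreal (indicator {0<..} y * (y powr (s - 1) * exp (- (\<alpha> * cosh u) * y))) \<partial>lborel)"
      by (intro nn_integral_cong) (auto simp: k_def mult_ac simp flip: ennreal_mult'' split: split_indicator)
    also have "\<dots> = ennreal (indicator {0..} u * cosh (\<nu> * u)) * ennreal (Gamma s * (\<alpha> * cosh u) powr (- s))"
      using assms s by (subst nn_integral_cmult, simp, subst nn_integral_powr_mult_exp_minus) auto
    also have "\<dots> = ennreal (Gamma s * \<alpha> powr (- s)) * ennreal (indicator {0..} u * (cosh (\<nu> * u) * cosh u powr (- s)))"
      using assms s by (simp add: powr_mult mult_ac flip: ennreal_mult'')
    finally show "(\<integral>\<^sup>+y. ennreal (k y u) \<partial>lborel) = \<dots>" .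
  qed
  also have "\<dots> = ennreal (Gamma s * \<alpha> powr (- s)) * (\<integral>\<^sup>+u. ennreal (indicator {0..} u * (cosh (\<nu> * u) * cosh u powr (- s))) \<partial>lborel)"
    by (subst nn_integral_cmult) auto
  also have "(\<integral>\<^sup>+u. ennreal (indicator {0..} u * (cosh (\<nu> * u) * cosh u powr (- s))) \<partial>lborel) =
      ennreal (LBINT u:{0..}. cosh (\<nu> * u) * cosh u powr (- s))"
    unfolding set_lebesgue_integral_def real_scaleR_def
    using set_integral_cosh_mult_cosh_powr(1)[OF assms(2), folded set_integral_atLeast_eq_greaterThan(1)]
    by (intro nn_integral_eq_integral) (auto simp: set_integrable_def)
  also have "(LBINT u:{0..}. cosh (\<nu> * u) * cosh u powr (- s)) = 2 powr (s - 2) * Beta ((s - \<nu>) / 2) ((s + \<nu>) / 2)"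
    using set_integral_cosh_mult_cosh_powr(2)[OF assms(2)] by (simp add: set_integral_atLeast_eq_greaterThan(2))
  also have "ennreal (Gamma s * \<alpha> powr (- s)) * ennreal \<dots> = ennreal R"
  proof -
    have "(s - \<nu>) / 2 + (s + \<nu>) / 2 = s" by (simp add: field_simps)
    moreover have "Gamma s \<noteq> 0" "Gamma s \<ge> 0" using Gamma_real_pos[OF s] by auto
    ultimately show ?thesis using s
      by (simp add: R_def Beta_def field_simps flip: ennreal_mult')
  qed
  finally have *: "(\<integral>\<^sup>+y. ennreal (indicator {0<..} y * (y powr (s - 1) * bessel_K \<nu> (\<alpha> * y))) \<partial>lborel) = ennreal R" .
  have R: "R \<ge> 0" unfolding R_def using assms by (intro mult_nonneg_nonneg Gamma_real_nonneg) auto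
  have "has_bochner_integral lborel (\<lambda>y. indicator {0<..} y * (y powr (s - 1) * bessel_K \<nu> (\<alpha> * y))) R"
    by (rule has_bochner_integral_nn_integral[OF _ _ R *]) (auto simp: bessel_K_nonneg)
  thus "set_integrable lborel {0<..} (\<lambda>y. y powr (s - 1) * bessel_K \<nu> (\<alpha> * y))"
    "(LBINT y:{0<..}. y powr (s - 1) * bessel_K \<nu> (\<alpha> * y)) = 2 powr (s - 2) * \<alpha> powr (- s) * Gamma ((s - \<nu>) / 2) * Gamma ((s + \<nu>) / 2)"
    unfolding R_def [symmetric] by (auto simp: has_bochner_integral_iff set_integrable_def set_lebesgue_integral_def)
qed

subsection \<open>Modified Lommel functions\<close>

text \<open>The regularised \<open>1F2\<close> with upper parameter 1 and lower parameters p and q.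
  With reciprocal Gamma factors, lowering p or q by 1 just multiplies the coefficients by a linear
  factor in n.\<close>

definition rGamma_series2 :: "real \<Rightarrow> real \<Rightarrow> real \<Rightarrow> real" where
  "rGamma_series2 p q z = (\<Sum>n. rGamma (p + real n) * rGamma (q + real n) * z ^ n)"

lemma rGamma_real_rec: "rGamma z = z * rGamma (z + 1)" for z :: real
  by (simp add: rGamma_plus1)

lemma summable_rGamma_series2:
  fixes p q z :: real
  assumes "p > 0" "q > 0"
  shows "summable (\<lambda>n. rGamma (p + real n) * rGamma (q + real n) * z ^ n)"
\<comment> \<open>Successive terms have ratio \<open>z / ((p + n) * (q + n))\<close>, which is at
  most 1/2 in modulus once \<open>n \<ge> 1\<close> and
  \<open>n \<ge> 2 * \<bar>z\<bar>\<close>.\<close>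
proof (rule summable_ratio_test[where c = "1/2" and N = "nat \<lceil>2 * \<bar>z\<bar>\<rceil> + 1"])
  fix n :: nat assume n: "n \<ge> nat \<lceil>2 * \<bar>z\<bar>\<rceil> + 1"
  define A where "A = rGamma (p + real (Suc n)) * rGamma (q + real (Suc n)) * z ^ n"
  have z: "2 * \<bar>z\<bar> \<le> real n" "n \<ge> 1" using n by linarith+
  have "real n \<le> real n * real n" using z(2) by simp
  also have "\<dots> \<le> (p + n) * (q + n)" using assms by (intro mult_mono) auto
  finally have le: "2 * \<bar>z\<bar> \<le> (p + n) * (q + n)" using z(1) by linarith
  have eq: "rGamma (p + real n) * rGamma (q + real n) * z ^ n = (p + n) * (q + n) * A"
    unfolding A_def by (subst rGamma_real_rec[of "p + n"], subst rGamma_real_rec[of "q + n"]) (simp add: add_ac)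
  have "norm (rGamma (p + real (Suc n)) * rGamma (q + real (Suc n)) * z ^ Suc n) = \<bar>z\<bar> * \<bar>A\<bar>"
    by (simp add: A_def abs_mult)
  also have "\<dots> \<le> ((p + n) * (q + n) / 2) * \<bar>A\<bar>" using le by (intro mult_right_mono) auto
  also have "\<dots> = 1 / 2 * norm (rGamma (p + real n) * rGamma (q + real n) * z ^ n)"
    unfolding eq using assms by (simp add: abs_mult)
  finally show "norm (rGamma (p + real (Suc n)) * rGamma (q + real (Suc n)) * z ^ Suc n) \<le>
      1 / 2 * norm (rGamma (p + real n) * rGamma (q + real n) * z ^ n)" .
qed simp

text \<open>The detached constant term is the source of the forcing term in the Lommel equation; it
  is all that survives when \<open>lommel_G\<close> is differentiated.\<close>

lemma rGamma_series2_split: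
  assumes "p > 0" "q > 0"
  shows "rGamma_series2 p q z = rGamma p * rGamma q + z * rGamma_series2 (p + 1) (q + 1) z"
proof -
  have "rGamma_series2 p q z = rGamma p * rGamma q + (\<Sum>n. rGamma (p + real (Suc n)) * rGamma (q + real (Suc n)) * z ^ Suc n)"
    unfolding rGamma_series2_def using suminf_split_head[OF summable_rGamma_series2[OF assms, of z]] by simp
  also have "(\<Sum>n. rGamma (p + real (Suc n)) * rGamma (q + real (Suc n)) * z ^ Suc n) =
     (\<Sum>n. z * (rGamma (p + 1 + real n) * rGamma (q + 1 + real n) * z ^ n))"
    by (intro suminf_cong) (simp add: add_ac)
  also have "\<dots> = z * rGamma_series2 (p + 1) (q + 1) z"
    unfolding rGamma_series2_def using assms by (intro suminf_mult summable_rGamma_series2) auto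
  finally show ?thesis .
qed

text \<open>Multiplying the derivative by z multiplies the n-th coefficient by n, and
  \<open>(n + q - 1) * rGamma (q + n) = rGamma (q - 1 + n)\<close>; the same holds with p. Stating
  this for \<open>z * D\<close> avoids a division and keeps \<open>z = 0\<close> available, where
  only continuity is wanted.\<close>

lemma rGamma_series2_derivative:
  fixes p q z :: real
  assumes "p > 0" "q > 0"
  obtains D where "(rGamma_series2 p q has_real_derivative D) (at z)"
    "z * D = rGamma_series2 p (q - 1) z - (q - 1) * rGamma_series2 p q z"
    "z * D = rGamma_series2 (p - 1) q z - (p - 1) * rGamma_series2 p q z"
proof -
  define c where "c n = rGamma (p + real n) * rGamma (q + real n)" for n
  have summable: "summable (\<lambda>n. c n * y ^ n)" for y
    unfolding c_def by (rule summable_rGamma_series2[OF assms])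
  define D where "D = (\<Sum>n. diffs c n * z ^ n)"
  have "((\<lambda>z. \<Sum>n. c n * z ^ n) has_real_derivative D) (at z)"
    unfolding D_def by (rule termdiffs_strong_converges_everywhere[OF summable])
  hence 1: "(rGamma_series2 p q has_real_derivative D) (at z)"
    by (simp add: rGamma_series2_def[abs_def] c_def)
  have "(\<lambda>n. diffs c n * z ^ n) sums D"
    unfolding D_def by (intro summable_sums termdiff_converges_all summable)
  hence "(\<lambda>n. z * (diffs c n * z ^ n)) sums (z * D)" by (rule sums_mult)
  hence "(\<lambda>n. real (Suc n) * c (Suc n) * z ^ Suc n) sums (z * D - real 0 * c 0 * z ^ 0)"
    by (simp add: diffs_def mult_ac)
  hence zD: "(\<lambda>n. real n * c n * z ^ n) sums (z * D)"
    by (subst (asm) sums_Suc_iff) simp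
  have L: "(\<lambda>n. c n * z ^ n) sums rGamma_series2 p q z"
    using summable_sums[OF summable] by (simp add: rGamma_series2_def c_def)
  have "(\<lambda>n. real n * c n * z ^ n + (q - 1) * (c n * z ^ n)) sums (z * D + (q - 1) * rGamma_series2 p q z)"
    by (intro sums_add zD sums_mult L)
  also have "(\<lambda>n. real n * c n * z ^ n + (q - 1) * (c n * z ^ n)) = (\<lambda>n. rGamma (p + real n) * rGamma (q - 1 + real n) * z ^ n)"
    by (subst (2) rGamma_real_rec) (simp add: c_def algebra_simps)
  finally have 2: "rGamma_series2 p (q - 1) z = z * D + (q - 1) * rGamma_series2 p q z"
    unfolding rGamma_series2_def by (rule sums_unique[symmetric])
  have "(\<lambda>n. real n * c n * z ^ n + (p - 1) * (c n * z ^ n)) sums (z * D + (p - 1) * rGamma_series2 p q z)"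
    by (intro sums_add zD sums_mult L)
  also have "(\<lambda>n. real n * c n * z ^ n + (p - 1) * (c n * z ^ n)) = (\<lambda>n. rGamma (p - 1 + real n) * rGamma (q + real n) * z ^ n)"
    by (subst (1) rGamma_real_rec) (simp add: c_def algebra_simps)
  finally have 3: "rGamma_series2 (p - 1) q z = z * D + (p - 1) * rGamma_series2 p q z"
    unfolding rGamma_series2_def by (rule sums_unique[symmetric])
  show ?thesis by (rule that[OF 1]) (simp_all add: 2 3)
qed

lemma normalised_lommel_t_eq:
  assumes "x > 0" "(a - \<nu> + 3) / 2 > 0" "(a + \<nu> + 3) / 2 > 0"
  shows "normalised_lommel_t a \<nu> x = (x / 2) powr (a + 1) * rGamma_series2 ((a - \<nu> + 3) / 2) ((a + \<nu> + 3) / 2) (x\<^sup>2 / 4)"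
proof -
  define p q z where "p = (a - \<nu> + 3) / 2" and "q = (a + \<nu> + 3) / 2" and "z = x\<^sup>2 / 4"
  have pq: "p > 0" "q > 0" using assms by (auto simp: p_def q_def)
  hence pos: "Gamma p \<noteq> 0" "Gamma q \<noteq> 0" by (metis Gamma_real_pos less_irrefl)+
  have rG: "rGamma (y + real n) = 1 / (pochhammer y n * Gamma y)" if "y > 0" for y n
  proof -
    have "pochhammer y n > 0" using that by (rule pochhammer_pos)
    thus ?thesis using pochhammer_rGamma[of y n] Gamma_real_pos[OF that]
      by (simp add: rGamma_inverse_Gamma field_simps)
  qed
  have "hyper_1F2 1 p q z = (\<Sum>n. 1 / (pochhammer p n * pochhammer q n) * z ^ n)"
    \<comment> \<open>The upper parameter 1 contributes \<open>pochhammer 1 n = fact n\<close>,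
      which cancels the factorial of the hypergeometric series.\<close>
    by (simp add: hyper_1F2_def eval_fps_def pochhammer_fact[symmetric])
  also have "\<dots> = (\<Sum>n. (Gamma p * Gamma q) * (rGamma (p + real n) * rGamma (q + real n) * z ^ n))"
    using pos by (intro suminf_cong) (simp add: rG pq)
  also have "\<dots> = (Gamma p * Gamma q) * rGamma_series2 p q z"
    unfolding rGamma_series2_def by (intro suminf_mult summable_rGamma_series2 pq)
  finally show ?thesis using pos assms(1)
    by (simp add: normalised_lommel_t_def powr_divide flip: p_def q_def z_def)
qed

text \<open>\<open>T1\<close> and \<open>T0\<close> obey a first-order system that mirrors the one
  for \<open>bessel_K \<nu>\<close> and \<open>bessel_K (\<nu> - 1)\<close> with opposite signs. In
  the derivative of the combination all mixed products cancel, the factor x absorbs the remaining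
  1/x terms, and only the forcing term of \<open>T0\<close> times \<open>bessel_K \<nu>\<close> is
  left.\<close>

lemma has_real_derivative_lommel_G:
  assumes "\<nu> > -1/2" "a \<ge> \<nu>" "x > 0"
  shows "(lommel_G a \<nu> has_real_derivative
      (2 powr (1 - a) / (Gamma ((a - \<nu> + 1) / 2) * Gamma ((a + \<nu> + 1) / 2)) * (x powr a * bessel_K \<nu> x))) (at x)"
proof -
  define p q where "p = (a - \<nu> + 3) / 2" and "q = (a + \<nu> + 3) / 2"
  have pq: "p > 1" "q > 1" using assms by (auto simp: p_def q_def)
  \<comment> \<open>Written so that differentiating the power of x cancels the \<open>q - 1\<close>
    (respectively \<open>p - 1\<close>) of the contiguous relation, leaving only the multiples of
    \<nu> and \<nu> - 1 required by the first-order system. Accordingly \<open>T1\<close> uses the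
    relation lowering q and \<open>T0\<close> the one lowering p.\<close>
  have q: "(a + 1) / 2 = q - 1 - \<nu> / 2" and p: "a / 2 = p - 1 + (\<nu> - 1) / 2"
    by (simp_all add: p_def q_def field_simps)
  define T1 T0 where "T1 x = (x / 2) powr (a + 1) * rGamma_series2 p q (x\<^sup>2 / 4)"
    and "T0 x = (x / 2) powr a * rGamma_series2 p (q - 1) (x\<^sup>2 / 4)" for x
  have T: "normalised_lommel_t a \<nu> x = T1 x" "normalised_lommel_t (a - 1) (\<nu> - 1) x = T0 x" if "x > 0" for x
    using normalised_lommel_t_eq[of x a \<nu>] normalised_lommel_t_eq[of x "a-1" "\<nu>-1"] that pq
    by (simp_all add: T1_def T0_def p_def q_def add_divide_distrib diff_divide_distrib)
  define z where "z = x\<^sup>2 / 4"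
  have z: "z = (x / 2) * (x / 2)" by (simp add: z_def power2_eq_square)
  define R where "R = rGamma (p - 1) * rGamma (q - 1)"
  have powr1: "(x / 2) powr (a + 1) = (x / 2) powr a * (x / 2)" using assms by (simp add: powr_add)
  have powr2: "(x / 2) powr a = (x / 2) powr (a - 1) * (x / 2)" using assms by (simp add: powr_diff)
  have pos: "p > 0" "q > 0" "q - 1 > 0" using pq by auto
  obtain D1 where D1: "(rGamma_series2 p q has_real_derivative D1) (at z)"
     "z * D1 = rGamma_series2 p (q - 1) z - (q - 1) * rGamma_series2 p q z"
    by (rule rGamma_series2_derivative[OF pos(1,2), of z]) blast
  obtain D0 where D0: "(rGamma_series2 p (q - 1) has_real_derivative D0) (at z)"
     "z * D0 = rGamma_series2 (p - 1) (q - 1) z - (p - 1) * rGamma_series2 p (q - 1) z"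
    by (rule rGamma_series2_derivative[OF pos(1,3), of z]) blast
  have split: "rGamma_series2 (p - 1) (q - 1) z = R + z * rGamma_series2 p q z"
    using rGamma_series2_split[of "p - 1" "q - 1" z] pq by (simp add: R_def)
  have dz: "((\<lambda>x. x\<^sup>2 / 4) has_real_derivative (x / 2)) (at x)"
    by (auto intro!: derivative_eq_intros)
  have dpow: "((\<lambda>x. (x / 2) powr b) has_real_derivative (b / 2 * (x / 2) powr (b - 1))) (at x)" for b
    by (rule DERIV_cong[OF DERIV_chain2[where f = "\<lambda>x. x powr b" and g = "\<lambda>x. x / 2",
            OF has_real_derivative_powr DERIV_cdivide[OF DERIV_ident]]])
       (use assms in simp_all)
  have dT1: "(T1 has_real_derivative (T0 x - \<nu> / x * T1 x)) (at x)"
  proof -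
    have ser: "((\<lambda>x. rGamma_series2 p q (x\<^sup>2 / 4)) has_real_derivative D1 * (x / 2)) (at x)"
      using D1(1) unfolding z_def
      by (rule DERIV_chain2[where f = "rGamma_series2 p q" and g = "\<lambda>x. x\<^sup>2 / 4" and x = x, OF _ dz])
    have pw: "((\<lambda>x. (x / 2) powr (a + 1)) has_real_derivative ((a + 1) / 2 * (x / 2) powr a)) (at x)"
      using dpow[of "a + 1"] by simp
    have der: "(T1 has_real_derivative (x / 2) powr (a + 1) * (D1 * (x / 2)) + (a + 1) / 2 * (x / 2) powr a * rGamma_series2 p q z) (at x)"
      unfolding T1_def z_def by (rule DERIV_mult'[OF pw ser])
    have 1: "(x / 2) powr (a + 1) * (D1 * (x / 2)) = (x / 2) powr a * (z * D1)"
      unfolding powr1 z by (simp only: mult_ac)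
    have "(x / 2) powr (a + 1) * (D1 * (x / 2)) + (a + 1) / 2 * (x / 2) powr a * rGamma_series2 p q z = 
        (x / 2) powr a * rGamma_series2 p (q - 1) z - \<nu> / 2 * ((x / 2) powr a * rGamma_series2 p q z)"
      unfolding 1 D1(2) q by (simp add: algebra_simps)
    also have "\<dots> = T0 x - \<nu> / x * T1 x"
      unfolding T0_def T1_def z_def[symmetric] powr1 using assms by simp
    finally show ?thesis by (rule DERIV_cong[OF der])
  qed
  have dT0: "(T0 has_real_derivative ((x / 2) powr (a - 1) * R + T1 x + (\<nu> - 1) / x * T0 x)) (at x)"
  proof -
    have ser: "((\<lambda>x. rGamma_series2 p (q - 1) (x\<^sup>2 / 4)) has_real_derivative D0 * (x / 2)) (at x)"
      using D0(1) unfolding z_def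
      by (rule DERIV_chain2[where f = "rGamma_series2 p (q - 1)" and g = "\<lambda>x. x\<^sup>2 / 4" and x = x, OF _ dz])
    have pw: "((\<lambda>x. (x / 2) powr a) has_real_derivative (a / 2 * (x / 2) powr (a - 1))) (at x)"
      by (rule dpow)
    have der: "(T0 has_real_derivative (x / 2) powr a * (D0 * (x / 2)) + a / 2 * (x / 2) powr (a - 1) * rGamma_series2 p (q - 1) z) (at x)"
      unfolding T0_def z_def by (rule DERIV_mult'[OF pw ser])
    have 1: "(x / 2) powr a * (D0 * (x / 2)) = (x / 2) powr (a - 1) * (z * D0)"
      unfolding powr2 z by (simp only: mult_ac)
    have "(x / 2) powr a * (D0 * (x / 2)) + a / 2 * (x / 2) powr (a - 1) * rGamma_series2 p (q - 1) z = 
        (x / 2) powr (a - 1) * R + (x / 2) powr (a - 1) * z * rGamma_series2 p q z + 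
        (\<nu> - 1) / 2 * ((x / 2) powr (a - 1) * rGamma_series2 p (q - 1) z)"
      unfolding 1 D0(2) split p by (simp add: algebra_simps)
    also have "\<dots> = (x / 2) powr (a - 1) * R + T1 x + (\<nu> - 1) / x * T0 x"
      unfolding T0_def T1_def z_def[symmetric] powr1 powr2 using assms by (simp add: z)
    finally show ?thesis by (rule DERIV_cong[OF der])
  qed
  have dK0: "(bessel_K \<nu> has_real_derivative (- bessel_K (\<nu> - 1) x - \<nu> / x * bessel_K \<nu> x)) (at x)"
    by (rule has_real_derivative_bessel_K(1)[OF assms(3)])
  have dK1: "(bessel_K (\<nu> - 1) has_real_derivative ((\<nu> - 1) / x * bessel_K (\<nu> - 1) x - bessel_K \<nu> x)) (at x)"
    using has_real_derivative_bessel_K(2)[OF assms(3), of "\<nu> - 1"] by simp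
  have alg: "1 * (k0 * t0 + k1 * t1) + ((- k1 - \<nu> / x * k0) * t0 + (w + t1 + (\<nu> - 1) / x * t0) * k0 +
       (((\<nu> - 1) / x * k1 - k0) * t1 + (t0 - \<nu> / x * t1) * k1)) * x = x * w * k0" for k0 k1 t0 t1 w
    using assms(3) by (simp add: field_simps)
  have 1: "((\<lambda>x. x * (bessel_K \<nu> x * T0 x + bessel_K (\<nu> - 1) x * T1 x)) has_real_derivative
     (x * ((x / 2) powr (a - 1) * R) * bessel_K \<nu> x)) (at x)"
    by (rule DERIV_cong[OF DERIV_mult[OF DERIV_ident DERIV_add[OF DERIV_mult[OF dK0 dT0] DERIV_mult[OF dK1 dT1]]]], rule alg)
  have "p - 1 = (a - \<nu> + 1) / 2" "q - 1 = (a + \<nu> + 1) / 2"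
    by (simp_all add: p_def q_def field_simps)
  hence R: "R = 1 / (Gamma ((a - \<nu> + 1) / 2) * Gamma ((a + \<nu> + 1) / 2))"
    by (simp only: R_def rGamma_inverse_Gamma inverse_mult_distrib divide_inverse mult_1_left)
  have "x * (x / 2) powr (a - 1) = 2 powr (1 - a) * x powr a"
    using assms(3) by (simp add: powr_divide powr_diff)
  hence 2: "x * ((x / 2) powr (a - 1) * R) * bessel_K \<nu> x =
      2 powr (1 - a) / (Gamma ((a - \<nu> + 1) / 2) * Gamma ((a + \<nu> + 1) / 2)) * (x powr a * bessel_K \<nu> x)"
    unfolding R by (simp add: mult_ac)
  have "((\<lambda>x. x * (bessel_K \<nu> x * T0 x + bessel_K (\<nu> - 1) x * T1 x)) has_real_derivative
      (2 powr (1 - a) / (Gamma ((a - \<nu> + 1) / 2) * Gamma ((a + \<nu> + 1) / 2)) * (x powr a * bessel_K \<nu> x))) (at x)"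
    by (rule DERIV_cong[OF 1 2])
  thus ?thesis
  proof (rule has_field_derivative_transform_within_open[where S = "{0<..}"])
    show "y * (bessel_K \<nu> y * T0 y + bessel_K (\<nu> - 1) y * T1 y) = lommel_G a \<nu> y" if "y \<in> {0<..}" for y
      using that by (simp add: lommel_G_def T)
  qed (use assms in auto)
qed

lemma powr_mult_bessel_K_tendsto_0:
  assumes "d > \<bar>\<nu>\<bar>"
  shows "((\<lambda>x. x powr d * bessel_K \<nu> x) \<longlongrightarrow> 0) (at_right 0)"
proof (rule Lim_null_comparison)
  \<comment> \<open>Strictly between the two: above \<open>\<bar>\<nu>\<bar>\<close> so that
    \<open>bessel_K_le\<close> applies, below d so that a positive power of x remains.\<close>
  define c where "c = (d + \<bar>\<nu>\<bar>) / 2"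
  have c: "c > \<bar>\<nu>\<bar>" "c < d" using assms by (auto simp: c_def field_simps)
  show "eventually (\<lambda>x. norm (x powr d * bessel_K \<nu> x) \<le> (2 * c) powr c / (c - \<bar>\<nu>\<bar>) * x powr (d - c)) (at_right 0)"
    using eventually_at_right_less[of 0]
  proof eventually_elim
    case (elim x)
    have "x powr d * bessel_K \<nu> x \<le> x powr d * ((2 * c / x) powr c / (c - \<bar>\<nu>\<bar>))"
      by (intro mult_left_mono bessel_K_le c elim) auto
    also have "\<dots> = (2 * c) powr c / (c - \<bar>\<nu>\<bar>) * x powr (d - c)"
      using elim c by (simp add: powr_divide powr_diff mult_ac)
    finally show ?case by (simp add: bessel_K_nonneg)
  qed
  have "((\<lambda>x::real. x powr (d - c)) \<longlongrightarrow> 0) (at_right 0)"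
    by (rule tendsto_zero_powrI[where b = "d - c"])
       (use c in \<open>auto intro: eventually_mono[OF eventually_at_right_less[of 0]]\<close>)
  thus "((\<lambda>x. (2 * c) powr c / (c - \<bar>\<nu>\<bar>) * x powr (d - c)) \<longlongrightarrow> 0) (at_right 0)"
    by (rule tendsto_mult_right_zero)
qed

text \<open>Near 0 the two summands behave like \<open>x powr (a + 1) * bessel_K \<nu> x\<close> and
  \<open>x powr (a + 2) * bessel_K (\<nu> - 1) x\<close>. They vanish because
  \<open>a + 1 > \<bar>\<nu>\<bar>\<close> and \<open>a + 2 > \<bar>\<nu> - 1\<bar>\<close>; in the
  extreme case \<open>a = \<nu>\<close> each inequality amounts to
  \<open>\<nu> > -1/2\<close>.\<close>

lemma lommel_G_tendsto_0:
  assumes "\<nu> > -1/2" "a \<ge> \<nu>"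
  shows "(lommel_G a \<nu> \<longlongrightarrow> 0) (at_right 0)"
proof -
  define p q where "p = (a - \<nu> + 3) / 2" and "q = (a + \<nu> + 3) / 2"
  have pq: "p > 1" "q > 1" using assms by (auto simp: p_def q_def)
  have T: "normalised_lommel_t a \<nu> x = (x / 2) powr (a + 1) * rGamma_series2 p q (x\<^sup>2 / 4)"
    "normalised_lommel_t (a - 1) (\<nu> - 1) x = (x / 2) powr a * rGamma_series2 p (q - 1) (x\<^sup>2 / 4)" if "x > 0" for x
    using normalised_lommel_t_eq[of x a \<nu>] normalised_lommel_t_eq[of x "a-1" "\<nu>-1"] that pq
    by (simp_all add: p_def q_def add_divide_distrib diff_divide_distrib)
  have cont: "((\<lambda>x. rGamma_series2 p q' (x\<^sup>2 / 4)) \<longlongrightarrow> rGamma_series2 p q' 0) (at_right 0)" if "q' > 0" for q'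
  proof -
    have "isCont (rGamma_series2 p q') 0"
      using rGamma_series2_derivative[of p q' 0] that pq by (metis DERIV_isCont less_trans zero_less_one)
    moreover have "((\<lambda>x::real. x\<^sup>2 / 4) \<longlongrightarrow> 0) (at_right 0)" by (auto intro!: tendsto_eq_intros)
    ultimately show ?thesis by (rule isCont_tendsto_compose)
  qed
  have "((\<lambda>x. 2 powr (- a) * (x powr (a + 1) * bessel_K \<nu> x) * rGamma_series2 p (q - 1) (x\<^sup>2 / 4) +
           2 powr (- a - 1) * (x powr (a + 2) * bessel_K (\<nu> - 1) x) * rGamma_series2 p q (x\<^sup>2 / 4)) \<longlongrightarrow>
           2 powr (- a) * 0 * rGamma_series2 p (q - 1) 0 + 2 powr (- a - 1) * 0 * rGamma_series2 p q 0) (at_right 0)"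
    by (intro tendsto_intros powr_mult_bessel_K_tendsto_0 cont) (use assms pq in auto)
  also have "?this \<longleftrightarrow> (lommel_G a \<nu> \<longlongrightarrow> 2 powr (- a) * 0 * rGamma_series2 p (q - 1) 0 + 2 powr (- a - 1) * 0 * rGamma_series2 p q 0) (at_right 0)"
  proof (rule filterlim_cong[OF refl refl])
    show "eventually (\<lambda>x. 2 powr (- a) * (x powr (a + 1) * bessel_K \<nu> x) * rGamma_series2 p (q - 1) (x\<^sup>2 / 4) +
           2 powr (- a - 1) * (x powr (a + 2) * bessel_K (\<nu> - 1) x) * rGamma_series2 p q (x\<^sup>2 / 4) = lommel_G a \<nu> x) (at_right 0)"
      using eventually_at_right_less[of 0]
    proof eventually_elim
      case (elim x)
      have "x powr (a + 1) = x powr a * x" "x powr (a + 2) = x powr a * x * x"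
           "2 powr (- a - 1) = 2 powr (-a) / (2::real)"
        using elim by (simp_all add: powr_add powr_diff power2_eq_square)
      thus ?case using elim
        by (simp add: lommel_G_def T powr_divide powr_minus powr_add field_simps)
    qed
  qed
  finally show ?thesis by simp
qed

lemma bessel_K_incomplete_Mellin:
  assumes "\<nu> > -1/2" "a \<ge> \<nu>" "\<alpha> > 0" "m \<ge> 0"
  shows "(LBINT y:{0<..<m}. y powr a * bessel_K \<nu> (\<alpha> * y)) =
     2 powr (a - 1) * \<alpha> powr (- a - 1) * Gamma ((a - \<nu> + 1) / 2) * Gamma ((a + \<nu> + 1) / 2) * lommel_G a \<nu> (\<alpha> * m)"
proof (cases "m = 0")
  case True
  thus ?thesis by (simp add: lommel_G_def set_lebesgue_integral_def)
next
  case False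
  with assms have m: "m > 0" by simp
  \<comment> \<open>The reciprocal of the constant in the derivative of \<open>lommel_G\<close>,
    divided by the \<open>\<alpha> powr (a + 1)\<close> that the scaling
    \<open>x = \<alpha> * y\<close> produces through \<open>x powr a\<close> and the chain
    rule.\<close>
  define C where "C = 2 powr (a - 1) * \<alpha> powr (- a - 1) * Gamma ((a - \<nu> + 1) / 2) * Gamma ((a + \<nu> + 1) / 2)"
  define F where "F y = C * lommel_G a \<nu> (\<alpha> * y)" for y
  define g1 g2 where "g1 = Gamma ((a - \<nu> + 1) / 2)" and "g2 = Gamma ((a + \<nu> + 1) / 2)"
  have pos: "g1 > 0" "g2 > 0"
    unfolding g1_def g2_def using assms by (auto intro!: Gamma_real_pos)
  have F: "(F has_real_derivative (y powr a * bessel_K \<nu> (\<alpha> * y))) (at y)" if "y > 0" for y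
  proof -
    have "(F has_real_derivative C * ((2 powr (1 - a) / (Gamma ((a - \<nu> + 1) / 2) * Gamma ((a + \<nu> + 1) / 2)) * 
              ((\<alpha> * y) powr a * bessel_K \<nu> (\<alpha> * y))) * \<alpha>)) (at y)"
      unfolding F_def
      by (rule DERIV_cmult, rule DERIV_chain2[OF has_real_derivative_lommel_G])
         (use assms that in \<open>auto intro!: derivative_eq_intros\<close>)
    also have "C * ((2 powr (1 - a) / (Gamma ((a - \<nu> + 1) / 2) * Gamma ((a + \<nu> + 1) / 2)) * 
              ((\<alpha> * y) powr a * bessel_K \<nu> (\<alpha> * y))) * \<alpha>) = y powr a * bessel_K \<nu> (\<alpha> * y)"
      using assms that pos unfolding C_def g1_def [symmetric] g2_def [symmetric]
      by (simp add: powr_mult powr_diff powr_minus field_simps)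
    finally show ?thesis .
  qed
  have "(LBINT y=ereal 0..ereal m. y powr a * bessel_K \<nu> (\<alpha> * y)) = F m - 0"
  proof (rule interval_integral_FTC_nonneg)
    show "(F has_real_derivative (y powr a * bessel_K \<nu> (\<alpha> * y))) (at y)" if "ereal 0 < ereal y" for y
      using F that by simp
    show "isCont (\<lambda>y. y powr a * bessel_K \<nu> (\<alpha> * y)) y" if "ereal 0 < ereal y" for y
    proof -
      have "isCont (bessel_K \<nu>) (\<alpha> * y)"
        by (rule DERIV_isCont[OF has_real_derivative_bessel_K(1)]) (use that assms in simp)
      hence "isCont (\<lambda>y. bessel_K \<nu> (\<alpha> * y)) y"
        by (intro isCont_o2[where f = "\<lambda>y. \<alpha> * y" and g = "bessel_K \<nu>"]) (auto intro!: continuous_intros)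
      moreover have "isCont (\<lambda>y. y powr a) y" using that by (intro continuous_intros) auto
      ultimately show ?thesis by (intro isCont_mult)
    qed
    show "AE y in lborel. ereal 0 < ereal y \<longrightarrow> ereal y < ereal m \<longrightarrow> 0 \<le> y powr a * bessel_K \<nu> (\<alpha> * y)"
      by (auto simp: bessel_K_nonneg)
    have "filterlim (\<lambda>y. \<alpha> * y) (at_right 0) (at_right 0)"
      using assms by (auto simp: filterlim_at intro!: tendsto_eq_intros eventually_at_right_less
            eventually_mono[OF eventually_at_right_less[of 0]])
    hence "((\<lambda>y. lommel_G a \<nu> (\<alpha> * y)) \<longlongrightarrow> 0) (at_right 0)"
      by (rule filterlim_compose[OF lommel_G_tendsto_0[OF assms(1,2)]])
    hence "(F \<longlongrightarrow> 0) (at_right 0)" unfolding F_def by (rule tendsto_mult_right_zero)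
    thus "((F \<circ> real_of_ereal) \<longlongrightarrow> 0) (at_right (ereal 0))"
      by (simp add: ereal_tendsto_simps1)
    have "isCont F m" using F[OF m] by (rule DERIV_isCont)
    hence "(F \<longlongrightarrow> F m) (at_left m)" by (simp add: isCont_def filterlim_at_split)
    thus "((F \<circ> real_of_ereal) \<longlongrightarrow> F m) (at_left (ereal m))"
      by (simp add: ereal_tendsto_simps1)
  qed (use m in auto)
  thus ?thesis using m by (simp add: interval_integral_Ioo F_def C_def)
qed

subsection \<open>Termwise integration\<close>

text \<open>The coefficient bound makes \<open>exp (B * y)\<close> a majorant of all partial sums at
  once, so dominated convergence permits termwise integration. The series of cosh, sinh and exp at
  \<open>b * y\<close> all satisfy it with \<open>B = \<bar>b\<bar>\<close>.\<close>

lemma power_series_integral_sums: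
  fixes c :: "nat \<Rightarrow> real" and f g :: "real \<Rightarrow> real" and B :: real
  assumes [measurable]: "S \<in> sets borel" "g \<in> borel_measurable borel"
    and S: "S \<subseteq> {0<..}"
    and f: "\<And>y. y \<in> S \<Longrightarrow> (\<lambda>n. c n * y ^ n) sums f y"
    and c: "\<And>n. \<bar>c n\<bar> \<le> B ^ n / fact n"
    and int: "set_integrable lborel S (\<lambda>y. exp (B * y) * g y)"
  shows "(\<lambda>n. c n * (LBINT y:S. y ^ n * g y)) sums (LBINT y:S. f y * g y)"
proof -
  define w where "w y = norm (indicator S y *\<^sub>R (exp (B * y) * g y))" for y
  have w: "integrable lborel w"
    using int unfolding w_def set_integrable_def by (rule integrable_norm)
  define s where "s N y = indicator S y * ((\<Sum>n<N. c n * y ^ n) * g y)" for N y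
  have B: "B \<ge> 0" using c[of 1] by simp
  have partial: "(\<Sum>n\<in>A. \<bar>c n * y ^ n\<bar>) \<le> exp (B * y)" if "y \<in> S" "finite A" for A y
  proof -
    have y: "y > 0" using that S by auto
    have "(\<Sum>n\<in>A. \<bar>c n * y ^ n\<bar>) \<le> (\<Sum>n\<in>A. (B * y) ^ n /\<^sub>R fact n)"
    proof (rule sum_mono)
      fix n
      have "\<bar>c n * y ^ n\<bar> \<le> B ^ n / fact n * y ^ n"
        using mult_right_mono[OF c[of n], of "y ^ n"] y by (simp add: abs_mult)
      thus "\<bar>c n * y ^ n\<bar> \<le> (B * y) ^ n /\<^sub>R fact n"
        by (simp add: power_mult_distrib divide_inverse mult_ac)
    qed
    also have "\<dots> \<le> (\<Sum>n. (B * y) ^ n /\<^sub>R fact n)"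
      using B y that exp_converges[of "B * y"] by (intro sum_le_suminf) (auto simp: sums_iff)
    also have "\<dots> = exp (B * y)" using exp_converges[of "B * y"] by (simp add: sums_iff)
    finally show ?thesis .
  qed
  have term_int: "integrable lborel (\<lambda>y. c n * (indicator S y * (y ^ n * g y)))" for n
  proof (rule Bochner_Integration.integrable_bound[OF w])
    show "AE y in lborel. norm (c n * (indicator S y * (y ^ n * g y))) \<le> norm (w y)"
    proof (rule AE_I2)
      fix y :: real
      show "norm (c n * (indicator S y * (y ^ n * g y))) \<le> norm (w y)"
      proof (cases "y \<in> S")
        case True
        have "\<bar>c n * y ^ n\<bar> * \<bar>g y\<bar> \<le> exp (B * y) * \<bar>g y\<bar>"
          using partial[OF True, of "{n}"] by (intro mult_right_mono) auto
        thus ?thesis using True by (simp add: w_def abs_mult mult_ac)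
      qed simp
    qed
  qed measurable
  have "(\<lambda>N. \<integral>y. s N y \<partial>lborel) \<longlonglongrightarrow> (\<integral>y. indicator S y * (f y * g y) \<partial>lborel)"
  proof (rule integral_dominated_convergence[where w = w])
    have lim: "(\<lambda>N. s N y) \<longlonglongrightarrow> indicator S y * (f y * g y)" for y
      using f[of y] by (cases "y \<in> S") (auto simp: s_def sums_def intro!: tendsto_intros)
    show s_meas: "s N \<in> borel_measurable lborel" for N unfolding s_def by measurable
    show "(\<lambda>y. indicator S y * (f y * g y)) \<in> borel_measurable lborel"
      by (rule borel_measurable_LIMSEQ_real[OF lim s_meas])
    show "AE y in lborel. (\<lambda>N. s N y) \<longlonglongrightarrow> indicator S y * (f y * g y)" using lim by simp
    show "AE y in lborel. norm (s N y) \<le> w y" for N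
    proof (rule AE_I2)
      fix y :: real
      show "norm (s N y) \<le> w y"
      proof (cases "y \<in> S")
        case True
        have "\<bar>\<Sum>n<N. c n * y ^ n\<bar> \<le> exp (B * y)"
          using partial[OF True, of "{..<N}"] by (intro order.trans[OF sum_abs]) simp
        hence "\<bar>\<Sum>n<N. c n * y ^ n\<bar> * \<bar>g y\<bar> \<le> exp (B * y) * \<bar>g y\<bar>" by (intro mult_right_mono) auto
        thus ?thesis using True by (simp add: s_def w_def abs_mult)
      qed (simp add: s_def w_def)
    qed
  qed (rule w)
  also have "(\<lambda>N. \<integral>y. s N y \<partial>lborel) = (\<lambda>N. \<Sum>n<N. c n * (LBINT y:S. y ^ n * g y))"
  proof
    fix N
    have "(\<integral>y. s N y \<partial>lborel) = (\<integral>y. (\<Sum>n<N. c n * (indicator S y * (y ^ n * g y))) \<partial>lborel)"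
      by (simp add: s_def sum_distrib_left sum_distrib_right mult_ac)
    also have "\<dots> = (\<Sum>n<N. \<integral>y. c n * (indicator S y * (y ^ n * g y)) \<partial>lborel)"
      by (rule Bochner_Integration.integral_sum[OF term_int])
    finally show "(\<integral>y. s N y \<partial>lborel) = (\<Sum>n<N. c n * (LBINT y:S. y ^ n * g y))"
      by (simp add: set_lebesgue_integral_def)
  qed
  finally show ?thesis by (simp add: sums_def set_lebesgue_integral_def)
qed

text \<open>Since \<open>cosh u \<ge> 1\<close>, the growing exponential is absorbed into the kernel
  at the price of reducing \<alpha> to \<open>\<alpha> - b\<close>. This is how
  \<open>\<bar>\<beta>\<bar> < \<alpha>\<close> secures convergence of all later integrals.\<close>

lemma exp_mult_bessel_K_le:
  assumes "0 \<le> b" "b < \<alpha>" "y > 0"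
  shows "exp (b * y) * bessel_K \<nu> (\<alpha> * y) \<le> bessel_K \<nu> ((\<alpha> - b) * y)"
proof -
  have "exp (b * y) * bessel_K \<nu> (\<alpha> * y) = (LBINT u:{0..}. exp (b * y) * (exp (- (\<alpha> * y) * cosh u) * cosh (\<nu> * u)))"
    by (simp add: bessel_K_def)
  also have "\<dots> \<le> (LBINT u:{0..}. exp (- ((\<alpha> - b) * y) * cosh u) * cosh (\<nu> * u))"
  proof (intro set_integral_mono set_integrable_mult_right impI set_integrable_bessel_K)
    fix u :: real
    have "b * y * 1 \<le> b * y * cosh u" using assms by (intro mult_left_mono cosh_real_ge_1) auto
    hence "exp (b * y) * exp (- (\<alpha> * y) * cosh u) \<le> exp (- ((\<alpha> - b) * y) * cosh u)"
      by (simp add: algebra_simps flip: exp_add)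
    thus "exp (b * y) * (exp (- (\<alpha> * y) * cosh u) * cosh (\<nu> * u)) \<le> exp (- ((\<alpha> - b) * y) * cosh u) * cosh (\<nu> * u)"
      unfolding mult.assoc [symmetric] by (rule mult_right_mono) simp
  qed (use assms in auto)
  finally show ?thesis by (simp add: bessel_K_def)
qed

lemma sums_even_terms:
  fixes f :: "nat \<Rightarrow> real"
  assumes "f sums s" "\<And>n. odd n \<Longrightarrow> f n = 0"
  shows "(\<lambda>n. f (2 * n)) sums s"
proof -
  have "(\<lambda>n. f (2 * n)) sums s \<longleftrightarrow> f sums s"
    by (rule sums_mono_reindex) (auto simp: strict_mono_def image_iff assms(2) elim!: evenE intro!: assms(2))
  thus ?thesis using assms by simp
qed

lemma sums_odd_terms:
  fixes f :: "nat \<Rightarrow> real"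
  assumes "f sums s" "\<And>n. even n \<Longrightarrow> f n = 0"
  shows "(\<lambda>n. f (2 * n + 1)) sums s"
proof -
  have "(\<lambda>n. f (2 * n + 1)) sums s \<longleftrightarrow> f sums s"
  proof (rule sums_mono_reindex)
    show "f n = 0" if "n \<notin> range (\<lambda>n. 2 * n + 1)" for n
      using that assms(2)[of n] by (cases "even n") (auto elim!: oddE)
  qed (auto simp: strict_mono_def)
  thus ?thesis using assms by simp
qed

lemma sum_atMost_odd_split:
  fixes f :: "nat \<Rightarrow> real"
  shows "(\<Sum>k=0..2*n+1. f k) = (\<Sum>k=0..n. f (2*k) + f (2*k+1))"
  by (induction n) (simp_all add: algebra_simps)

lemma pochhammer_three_halves: "pochhammer (3/2 :: real) n = pochhammer (1/2) n * (2 * real n + 1)"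
  by (induction n) (simp_all add: pochhammer_Suc field_simps)

section \<open>Moments of the Bessel kernel and hypergeometric series\<close>

locale vg_kernel =
  fixes \<nu> \<alpha> :: real
  assumes nu: "\<nu> > -1/2" and alpha: "\<alpha> > 0"
begin

definition h :: "real \<Rightarrow> real" where
  "h y = y powr \<nu> * bessel_K \<nu> (\<alpha> * y)"

definition W :: real where
  "W = 2 powr (\<nu> - 1) * \<alpha> powr (- \<nu> - 1)"

text \<open>The n-th moment of \<open>h\<close> over the half-line. The incomplete moments carry the
  same factor times a value of \<open>lommel_G\<close>, so one coefficient serves both parts of the
  formula.\<close>

definition moment_coeff :: "nat \<Rightarrow> real" where
  "moment_coeff n = W * (2 / \<alpha>) ^ n * Gamma ((real n + 1) / 2) * Gamma (\<nu> + (real n + 1) / 2)"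

lemma h_nonneg: "h y \<ge> 0"
  by (simp add: h_def bessel_K_nonneg)

lemma borel_measurable_h [measurable]: "h \<in> borel_measurable borel"
  unfolding h_def by measurable

lemma power_mult_h: "y > 0 \<Longrightarrow> y ^ n * h y = y powr (\<nu> + n) * bessel_K \<nu> (\<alpha> * y)"
  by (simp add: h_def powr_add powr_realpow)

lemma moment_coeff_eq:
  "2 powr (\<nu> + n - 1) * \<alpha> powr (- (\<nu> + n) - 1) * Gamma ((real n + 1) / 2) * Gamma (\<nu> + (real n + 1) / 2) = moment_coeff n"
proof -
  have "2 powr (\<nu> + n - 1) = 2 powr (\<nu> - 1) * 2 ^ n"
    by (simp add: powr_add powr_diff powr_realpow)
  moreover have "\<alpha> powr (- (\<nu> + n) - 1) = \<alpha> powr (- \<nu> - 1) / \<alpha> ^ n"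
    using alpha by (simp add: powr_diff powr_minus powr_add powr_realpow divide_simps)
  ultimately show ?thesis
    by (simp add: moment_coeff_def W_def power_divide)
qed

lemma integral_power_mult_h: "(LBINT y:{0<..}. y ^ n * h y) = moment_coeff n"
proof -
  have "(LBINT y:{0<..}. y ^ n * h y) = (LBINT y:{0<..}. y powr ((\<nu> + n + 1) - 1) * bessel_K \<nu> (\<alpha> * y))"
    by (rule set_lebesgue_integral_cong) (auto simp: power_mult_h)
  also have "\<dots> = 2 powr (\<nu> + n + 1 - 2) * \<alpha> powr (- (\<nu> + n + 1)) * Gamma ((\<nu> + n + 1 - \<nu>) / 2) * Gamma ((\<nu> + n + 1 + \<nu>) / 2)"
    by (rule bessel_K_Mellin) (use nu alpha in auto)
  also have "\<nu> + n + 1 - 2 = \<nu> + n - 1" by simp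
  also have "- (\<nu> + n + 1) = - (\<nu> + n) - 1" by simp
  also have "\<nu> + n + 1 - \<nu> = real n + 1" by simp
  also have "(\<nu> + n + 1 + \<nu>) / 2 = \<nu> + (real n + 1) / 2" by (simp add: field_simps)
  also note moment_coeff_eq
  finally show ?thesis .
qed

lemma integral_power_mult_h_incomplete:
  assumes "m \<ge> 0"
  shows "(LBINT y:{0<..<m}. y ^ n * h y) = moment_coeff n * lommel_G (\<nu> + n) \<nu> (\<alpha> * m)"
proof -
  have "(LBINT y:{0<..<m}. y ^ n * h y) = (LBINT y:{0<..<m}. y powr (\<nu> + n) * bessel_K \<nu> (\<alpha> * y))"
    by (rule set_lebesgue_integral_cong) (auto simp: power_mult_h)
  also have "\<dots> = 2 powr (\<nu> + n - 1) * \<alpha> powr (- (\<nu> + n) - 1) * Gamma ((\<nu> + n - \<nu> + 1) / 2) * Gamma ((\<nu> + n + \<nu> + 1) / 2) *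
     lommel_G (\<nu> + n) \<nu> (\<alpha> * m)"
    by (rule bessel_K_incomplete_Mellin) (use nu alpha assms in auto)
  also have "\<nu> + n - \<nu> + 1 = real n + 1" by simp
  also have "(\<nu> + n + \<nu> + 1) / 2 = \<nu> + (real n + 1) / 2" by (simp add: field_simps)
  also note moment_coeff_eq
  finally show ?thesis .
qed

lemma set_integrable_exp_power_h:
  assumes "\<bar>b\<bar> < \<alpha>"
  shows "set_integrable lborel {0<..} (\<lambda>y. exp (b * y) * (y ^ n * h y))"
proof (rule set_integrable_bound)
  show "set_integrable lborel {0<..} (\<lambda>y. y powr ((\<nu> + n + 1) - 1) * bessel_K \<nu> ((\<alpha> - \<bar>b\<bar>) * y))"
    by (rule bessel_K_Mellin) (use nu assms in auto)
  show "set_borel_measurable lborel {0<..} (\<lambda>y. exp (b * y) * (y ^ n * h y))"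
    unfolding set_borel_measurable_def by measurable
  show "AE y in lborel. y \<in> {0<..} \<longrightarrow> norm (exp (b * y) * (y ^ n * h y)) \<le> norm (y powr ((\<nu> + n + 1) - 1) * bessel_K \<nu> ((\<alpha> - \<bar>b\<bar>) * y))"
  proof (intro AE_I2 impI)
    fix y :: real assume "y \<in> {0<..}"
    hence y: "y > 0" by simp
    have "exp (b * y) * (y ^ n * h y) \<le> exp (\<bar>b\<bar> * y) * (y ^ n * h y)"
      using y h_nonneg[of y] by (intro mult_right_mono) auto
    also have "\<dots> = y powr (\<nu> + n) * (exp (\<bar>b\<bar> * y) * bessel_K \<nu> (\<alpha> * y))"
      using y by (simp add: power_mult_h)
    also have "\<dots> \<le> y powr (\<nu> + n) * bessel_K \<nu> ((\<alpha> - \<bar>b\<bar>) * y)"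
      using assms y by (intro mult_left_mono exp_mult_bessel_K_le) auto
    finally show "norm (exp (b * y) * (y ^ n * h y)) \<le> norm (y powr ((\<nu> + n + 1) - 1) * bessel_K \<nu> ((\<alpha> - \<bar>b\<bar>) * y))"
      using y h_nonneg[of y] bessel_K_nonneg[of \<nu>] by (simp add: abs_mult)
  qed
qed

lemma moment_coeff_pos: "moment_coeff n > 0"
proof -
  have "\<nu> + (real n + 1) / 2 > 0" using nu by (simp add: field_simps)
  thus ?thesis unfolding moment_coeff_def W_def using alpha
    by (intro mult_pos_pos Gamma_real_pos) auto
qed

text \<open>Raising the exponent by 2 shifts both Gamma arguments by exactly 1. Integer shifts give
  Pochhammer symbols, which is why even and odd powers are treated separately.\<close>

lemma moment_coeff_add:
  "moment_coeff (N + 2 * i) = moment_coeff N * (4 / \<alpha>\<^sup>2) ^ i * pochhammer ((real N + 1) / 2) i * pochhammer (\<nu> + (real N + 1) / 2) i"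
proof -
  have *: "Gamma (z + real i) = Gamma z * pochhammer z i" if "z > 0" for z :: real
  proof -
    have "z \<notin> \<int>\<^sub>\<le>\<^sub>0" using that by (auto elim!: nonpos_Ints_cases)
    moreover have "Gamma z \<noteq> 0" using that by (metis Gamma_real_pos less_irrefl)
    ultimately show ?thesis by (simp add: pochhammer_Gamma)
  qed
  have 1: "(real (N + 2 * i) + 1) / 2 = (real N + 1) / 2 + real i" by (simp add: field_simps)
  have 2: "(2 / \<alpha>) ^ (N + 2 * i) = (2 / \<alpha>) ^ N * (4 / \<alpha>\<^sup>2) ^ i"
    by (simp add: power_add power_mult power_divide)
  have "\<nu> + (real N + 1) / 2 > 0" using nu by (simp add: field_simps)
  thus ?thesis
    unfolding moment_coeff_def 1 2 add.assoc [symmetric]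
    by (subst (1 2) *) (auto simp: mult_ac add_pos_nonneg)
qed

text \<open>The identity \<open>fact (2 * i) = 4 ^ i * pochhammer (1/2) i * fact i\<close> supplies
  the lower parameter 1/2, and its power of 4 cancels the one from
  \<open>moment_coeff_add\<close>.\<close>

lemma integral_cosh_mult_h:
  assumes "\<bar>b\<bar> < \<alpha>"
  shows "(LBINT y:{0<..}. cosh (b * y) * (y ^ N * h y)) =
     moment_coeff N * hyper_2F1 ((real N + 1) / 2) (\<nu> + (real N + 1) / 2) (1/2) (b\<^sup>2 / \<alpha>\<^sup>2)"
proof -
  define c where "c n = (if even n then b ^ n / fact n else 0)" for n
  have "(\<lambda>n. c n * (LBINT y:{0<..}. y ^ n * (y ^ N * h y))) sums (LBINT y:{0<..}. cosh (b * y) * (y ^ N * h y))"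
  proof (rule power_series_integral_sums[where B = "\<bar>b\<bar>"])
    show "(\<lambda>n. c n * y ^ n) sums cosh (b * y)" for y
    proof -
      have "(\<lambda>n. c n * y ^ n) = (\<lambda>n. if even n then (b * y) ^ n /\<^sub>R fact n else 0)"
        by (auto simp: c_def power_mult_distrib divide_inverse mult_ac)
      thus ?thesis using cosh_converges[of "b * y"] by simp
    qed
    show "\<bar>c n\<bar> \<le> \<bar>b\<bar> ^ n / fact n" for n by (simp add: c_def power_abs)
    show "set_integrable lborel {0<..} (\<lambda>y. exp (\<bar>b\<bar> * y) * (y ^ N * h y))"
      by (rule set_integrable_exp_power_h) (use assms in auto)
  qed auto
  also have "(\<lambda>n. LBINT y:{0<..}. y ^ n * (y ^ N * h y)) = (\<lambda>n. moment_coeff (N + n))"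
    by (simp add: integral_power_mult_h[symmetric] power_add mult_ac)
  finally have "(\<lambda>i. c (2 * i) * moment_coeff (N + 2 * i)) sums (LBINT y:{0<..}. cosh (b * y) * (y ^ N * h y))"
    by (rule sums_even_terms) (simp add: c_def)
  also have "(\<lambda>i. c (2 * i) * moment_coeff (N + 2 * i)) =
     (\<lambda>i. moment_coeff N * (pochhammer ((real N + 1) / 2) i * pochhammer (\<nu> + (real N + 1) / 2) i / (pochhammer (1/2) i * fact i) * (b\<^sup>2 / \<alpha>\<^sup>2) ^ i))"
  proof
    fix i
    have "fact (2 * i) = (4 ^ i * pochhammer (1/2) i * fact i :: real)"
      by (simp add: fact_double power_mult)
    moreover have "pochhammer (1/2 :: real) i > 0" by (rule pochhammer_pos) simp
    ultimately show "c (2 * i) * moment_coeff (N + 2 * i) = moment_coeff N * (pochhammer ((real N + 1) / 2) i * pochhammer (\<nu> + (real N + 1) / 2) i / (pochhammer (1/2) i * fact i) * (b\<^sup>2 / \<alpha>\<^sup>2) ^ i)"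
      using alpha by (simp add: c_def moment_coeff_add power_divide power_mult)
  qed
  finally have *: "(\<lambda>i. moment_coeff N * (pochhammer ((real N + 1) / 2) i * pochhammer (\<nu> + (real N + 1) / 2) i / (pochhammer (1/2) i * fact i) * (b\<^sup>2 / \<alpha>\<^sup>2) ^ i))
     sums (LBINT y:{0<..}. cosh (b * y) * (y ^ N * h y))" .
  \<comment> \<open>Dividing by the nonzero moment leaves exactly the hypergeometric series, whose
    convergence is thus inherited from the integral.\<close>
  have "moment_coeff N \<noteq> 0" using moment_coeff_pos[of N] by simp
  hence "(\<lambda>i. pochhammer ((real N + 1) / 2) i * pochhammer (\<nu> + (real N + 1) / 2) i / (pochhammer (1/2) i * fact i) * (b\<^sup>2 / \<alpha>\<^sup>2) ^ i)
     sums ((LBINT y:{0<..}. cosh (b * y) * (y ^ N * h y)) / moment_coeff N)"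
    using sums_divide[OF *, of "moment_coeff N"] by simp
  hence "hyper_2F1 ((real N + 1) / 2) (\<nu> + (real N + 1) / 2) (1/2) (b\<^sup>2 / \<alpha>\<^sup>2) = (LBINT y:{0<..}. cosh (b * y) * (y ^ N * h y)) / moment_coeff N"
    by (simp add: hyper_2F1_def eval_fps_def sums_iff)
  thus ?thesis using \<open>moment_coeff N \<noteq> 0\<close> by simp
qed

text \<open>The exponent \<open>N - 1\<close> compensates for the lowest power of sinh, so that the
  total exponents are again \<open>N + 2 * i\<close> and the upper parameters agree with the cosh
  case; the odd factorials change 1/2 to 3/2. The case \<open>b = 0\<close> is set apart because the
  argument divides by b.\<close>

lemma integral_sinh_mult_h:
  assumes "\<bar>b\<bar> < \<alpha>" "N > 0"
  shows "(LBINT y:{0<..}. sinh (b * y) * (y ^ (N - 1) * h y)) =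
     b * moment_coeff N * hyper_2F1 ((real N + 1) / 2) (\<nu> + (real N + 1) / 2) (3/2) (b\<^sup>2 / \<alpha>\<^sup>2)"
proof (cases "b = 0")
  case False
  define c where "c n = (if even n then 0 else b ^ n / fact n)" for n
  have "(\<lambda>n. c n * (LBINT y:{0<..}. y ^ n * (y ^ (N - 1) * h y))) sums (LBINT y:{0<..}. sinh (b * y) * (y ^ (N - 1) * h y))"
  proof (rule power_series_integral_sums[where B = "\<bar>b\<bar>"])
    show "(\<lambda>n. c n * y ^ n) sums sinh (b * y)" for y
    proof -
      have "(\<lambda>n. c n * y ^ n) = (\<lambda>n. if even n then 0 else (b * y) ^ n /\<^sub>R fact n)"
        by (auto simp: c_def power_mult_distrib divide_inverse mult_ac)
      thus ?thesis using sinh_converges[of "b * y"] by simp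
    qed
    show "\<bar>c n\<bar> \<le> \<bar>b\<bar> ^ n / fact n" for n by (simp add: c_def power_abs)
    show "set_integrable lborel {0<..} (\<lambda>y. exp (\<bar>b\<bar> * y) * (y ^ (N - 1) * h y))"
      by (rule set_integrable_exp_power_h) (use assms in auto)
  qed auto
  also have "(\<lambda>n. LBINT y:{0<..}. y ^ n * (y ^ (N - 1) * h y)) = (\<lambda>n. moment_coeff (N - 1 + n))"
    by (simp add: integral_power_mult_h[symmetric] power_add mult_ac)
  finally have "(\<lambda>i. c (2 * i + 1) * moment_coeff (N - 1 + (2 * i + 1))) sums (LBINT y:{0<..}. sinh (b * y) * (y ^ (N - 1) * h y))"
    by (rule sums_odd_terms) (simp add: c_def)
  also have "(\<lambda>i. c (2 * i + 1) * moment_coeff (N - 1 + (2 * i + 1))) =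
     (\<lambda>i. b * moment_coeff N * (pochhammer ((real N + 1) / 2) i * pochhammer (\<nu> + (real N + 1) / 2) i / (pochhammer (3/2) i * fact i) * (b\<^sup>2 / \<alpha>\<^sup>2) ^ i))"
  proof
    fix i
    have "fact (2 * i + 1) = (4 ^ i * pochhammer (3/2) i * fact i :: real)"
      by (simp add: fact_double power_mult pochhammer_three_halves)
    moreover have "pochhammer (3/2 :: real) i > 0" by (rule pochhammer_pos) simp
    moreover have "N - 1 + (2 * i + 1) = N + 2 * i" using assms by simp
    moreover have "b ^ (2 * i + 1) = b * (b\<^sup>2) ^ i" by (simp add: power_mult)
    ultimately show "c (2 * i + 1) * moment_coeff (N - 1 + (2 * i + 1)) = b * moment_coeff N * (pochhammer ((real N + 1) / 2) i * pochhammer (\<nu> + (real N + 1) / 2) i / (pochhammer (3/2) i * fact i) * (b\<^sup>2 / \<alpha>\<^sup>2) ^ i)"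
      using alpha by (simp add: c_def moment_coeff_add power_divide del: fact_Suc power_Suc)
  qed
  finally have *: "(\<lambda>i. b * moment_coeff N * (pochhammer ((real N + 1) / 2) i * pochhammer (\<nu> + (real N + 1) / 2) i / (pochhammer (3/2) i * fact i) * (b\<^sup>2 / \<alpha>\<^sup>2) ^ i))
     sums (LBINT y:{0<..}. sinh (b * y) * (y ^ (N - 1) * h y))" .
  have "b * moment_coeff N \<noteq> 0" using moment_coeff_pos[of N] False by simp
  hence "(\<lambda>i. pochhammer ((real N + 1) / 2) i * pochhammer (\<nu> + (real N + 1) / 2) i / (pochhammer (3/2) i * fact i) * (b\<^sup>2 / \<alpha>\<^sup>2) ^ i)
     sums ((LBINT y:{0<..}. sinh (b * y) * (y ^ (N - 1) * h y)) / (b * moment_coeff N))"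
    using sums_divide[OF *, of "b * moment_coeff N"] by simp
  hence "hyper_2F1 ((real N + 1) / 2) (\<nu> + (real N + 1) / 2) (3/2) (b\<^sup>2 / \<alpha>\<^sup>2) = (LBINT y:{0<..}. sinh (b * y) * (y ^ (N - 1) * h y)) / (b * moment_coeff N)"
    by (simp add: hyper_2F1_def eval_fps_def sums_iff)
  thus ?thesis using \<open>b * moment_coeff N \<noteq> 0\<close> by simp
qed simp

lemma integral_exp_mult_h_incomplete_sums:
  assumes "\<bar>b\<bar> < \<alpha>" "m \<ge> 0"
  shows "(\<lambda>j. b ^ j / fact j * (moment_coeff (N + j) * lommel_G (\<nu> + real (N + j)) \<nu> (\<alpha> * m)))
     sums (LBINT y:{0<..<m}. exp (b * y) * (y ^ N * h y))"
proof -
  have "(\<lambda>n. b ^ n / fact n * (LBINT y:{0<..<m}. y ^ n * (y ^ N * h y))) sums (LBINT y:{0<..<m}. exp (b * y) * (y ^ N * h y))"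
  proof (rule power_series_integral_sums[where B = "\<bar>b\<bar>"])
    show "(\<lambda>n. b ^ n / fact n * y ^ n) sums exp (b * y)" for y
      using exp_converges[of "b * y"] by (simp add: power_mult_distrib divide_inverse mult_ac)
    show "\<bar>b ^ n / fact n\<bar> \<le> \<bar>b\<bar> ^ n / fact n" for n by (simp add: power_abs)
    show "set_integrable lborel {0<..<m} (\<lambda>y. exp (\<bar>b\<bar> * y) * (y ^ N * h y))"
      by (rule set_integrable_subset[OF set_integrable_exp_power_h]) (use assms in auto)
  qed auto
  also have "(\<lambda>n. LBINT y:{0<..<m}. y ^ n * (y ^ N * h y)) = (\<lambda>n. moment_coeff (N + n) * lommel_G (\<nu> + real (N + n)) \<nu> (\<alpha> * m))"
    using assms by (subst integral_power_mult_h_incomplete[symmetric]) (simp_all add: power_add mult_ac)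
  finally show ?thesis .
qed
end

section \<open>Binomial expansion and splitting of the folded integral\<close>

lemma set_integral_sum_finite:
  fixes f :: "'i \<Rightarrow> real \<Rightarrow> real"
  assumes "\<And>i. i \<in> I \<Longrightarrow> set_integrable M A (f i)"
  shows "set_integrable M A (\<lambda>x. \<Sum>i\<in>I. f i x)"
    and "(LINT x:A|M. (\<Sum>i\<in>I. f i x)) = (\<Sum>i\<in>I. LINT x:A|M. f i x)"
proof -
  have "integrable M (\<lambda>x. indicator A x *\<^sub>R f i x)" if "i \<in> I" for i
    using assms[OF that] by (simp add: set_integrable_def)
  thus "set_integrable M A (\<lambda>x. \<Sum>i\<in>I. f i x)" "(LINT x:A|M. (\<Sum>i\<in>I. f i x)) = (\<Sum>i\<in>I. LINT x:A|M. f i x)"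
    unfolding set_integrable_def set_lebesgue_integral_def scaleR_sum_right
    by (auto intro!: Bochner_Integration.integrable_sum Bochner_Integration.integral_sum)
qed

text \<open>The total degree is odd, so even powers of m go with odd powers of y and conversely. The
  sign of \<open>- y\<close> thus depends only on the parity of the power of m, and the two
  exponentials merge into a cosh or a sinh.\<close>

lemma odd_binomial_exp_expansion:
  fixes m y t :: real
  shows "(m + y) ^ (2*p+1) * exp t - (m - y) ^ (2*p+1) * exp (- t) =
    (\<Sum>k=0..p. 2 * m ^ (2*k) * real ((2*p+1) choose (2*k)) * (cosh t * y ^ (2*p+1 - 2*k)) +
              2 * m ^ (2*k+1) * real ((2*p+1) choose (2*k+1)) * (sinh t * y ^ (2*p+1 - 2*k - 1)))"
proof -
  let ?r = "2*p+1"
  have 1: "(m + y) ^ ?r = (\<Sum>k=0..?r. real (?r choose k) * m ^ k * y ^ (?r - k))"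
    by (subst binomial_ring) (simp only: atMost_atLeast0)
  have 2: "(m - y) ^ ?r = (\<Sum>k=0..?r. real (?r choose k) * m ^ k * (- y) ^ (?r - k))"
    using binomial_ring[of m "- y" ?r] by (simp only: atMost_atLeast0 add_uminus_conv_diff)
  have "(m + y) ^ ?r * exp t - (m - y) ^ ?r * exp (- t) =
      (\<Sum>k=0..?r. real (?r choose k) * m ^ k * (y ^ (?r - k) * exp t - (- y) ^ (?r - k) * exp (- t)))"
    unfolding 1 2 sum_distrib_right sum_subtractf [symmetric] by (intro sum.cong refl) (simp only: algebra_simps)
  also have "\<dots> = (\<Sum>k=0..p. real (?r choose (2*k)) * m ^ (2*k) * (y ^ (?r - 2*k) * exp t - (- y) ^ (?r - 2*k) * exp (- t)) +
       real (?r choose (2*k+1)) * m ^ (2*k+1) * (y ^ (?r - (2*k+1)) * exp t - (- y) ^ (?r - (2*k+1)) * exp (- t)))"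
    by (rule sum_atMost_odd_split)
  also have "\<dots> = (\<Sum>k=0..p. 2 * m ^ (2*k) * real (?r choose (2*k)) * (cosh t * y ^ (?r - 2*k)) +
              2 * m ^ (2*k+1) * real (?r choose (2*k+1)) * (sinh t * y ^ (?r - 2*k - 1)))"
  proof (rule sum.cong[OF refl], goal_cases)
    case (1 k)
    hence k: "odd (?r - 2*k)" "even (?r - (2*k+1))" by auto
    have c: "y ^ (?r - 2*k) * exp t - (- y) ^ (?r - 2*k) * exp (- t) = 2 * (cosh t * y ^ (?r - 2*k))"
      unfolding power_minus_odd[OF k(1)] by (simp add: cosh_def algebra_simps)
    have s: "y ^ (?r - (2*k+1)) * exp t - (- y) ^ (?r - (2*k+1)) * exp (- t) = 2 * (sinh t * y ^ (?r - (2*k+1)))"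
      unfolding power_minus_even[OF k(2)] by (simp add: sinh_def algebra_simps)
    show ?case unfolding c s by (simp only: diff_diff_left mult_ac)
  qed
  finally show ?thesis .
qed

context vg_kernel
begin

lemma set_integrable_cosh_sinh_h:
  assumes "\<bar>b\<bar> < \<alpha>"
  shows "set_integrable lborel {0<..} (\<lambda>y. cosh (b * y) * (y ^ N * h y))"
    and "set_integrable lborel {0<..} (\<lambda>y. sinh (b * y) * (y ^ N * h y))"
proof -
  have 1: "set_integrable lborel {0<..} (\<lambda>y. exp (b * y) * (y ^ N * h y))"
    "set_integrable lborel {0<..} (\<lambda>y. exp (- b * y) * (y ^ N * h y))"
    by (rule set_integrable_exp_power_h; use assms in simp)+
  show "set_integrable lborel {0<..} (\<lambda>y. cosh (b * y) * (y ^ N * h y))"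
    using set_integrable_mult_right[OF set_integral_add(1)[OF 1], of "1/2"]
    by (simp add: cosh_def algebra_simps)
  show "set_integrable lborel {0<..} (\<lambda>y. sinh (b * y) * (y ^ N * h y))"
    using set_integrable_mult_right[OF set_integral_diff(1)[OF 1], of "1/2"]
    by (simp add: sinh_def algebra_simps)
qed

text \<open>The binomial terms of index \<open>2 * k\<close> and \<open>2 * k + 1\<close> are kept
  together because both integrals produce the same \<open>moment_coeff (r - 2 * k)\<close>.\<close>

lemma integral_odd_part:
  fixes m b :: real
  assumes b: "\<bar>b\<bar> < \<alpha>" and r: "r = 2 * p + 1"
  shows "set_integrable lborel {0<..} (\<lambda>y. ((m + y) ^ r * exp (b * y) - (m - y) ^ r * exp (- (b * y))) * h y)" (is ?int)
    and "(LBINT y:{0<..}. ((m + y) ^ r * exp (b * y) - (m - y) ^ r * exp (- (b * y))) * h y) =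
      (\<Sum>k=0..p. 2 * m ^ (2*k) * moment_coeff (r - 2*k) *
        (real (r choose (2*k)) * hyper_2F1 ((real r - 2 * real k + 1) / 2) (\<nu> + (real r - 2 * real k + 1) / 2) (1/2) (b\<^sup>2 / \<alpha>\<^sup>2) +
         b * m * real (r choose (2*k+1)) * hyper_2F1 ((real r - 2 * real k + 1) / 2) (\<nu> + (real r - 2 * real k + 1) / 2) (3/2) (b\<^sup>2 / \<alpha>\<^sup>2)))" (is ?eq)
proof -
  define C S where "C k = (\<lambda>y. 2 * m ^ (2*k) * real (r choose (2*k)) * (cosh (b * y) * (y ^ (r - 2*k) * h y)))"
    and "S k = (\<lambda>y. 2 * m ^ (2*k+1) * real (r choose (2*k+1)) * (sinh (b * y) * (y ^ (r - 2*k - 1) * h y)))" for k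
  have expand: "((m + y) ^ r * exp (b * y) - (m - y) ^ r * exp (- (b * y))) * h y = (\<Sum>k=0..p. C k y + S k y)" for y
    unfolding r odd_binomial_exp_expansion C_def S_def sum_distrib_right
    by (intro sum.cong refl) (simp only: distrib_right mult.assoc)
  have C: "set_integrable lborel {0<..} (C k)" and S: "set_integrable lborel {0<..} (S k)" for k
    unfolding C_def S_def by (intro set_integrable_mult_right impI set_integrable_cosh_sinh_h b)+
  have CS: "set_integrable lborel {0<..} (\<lambda>y. C k y + S k y)" for k
    by (rule set_integral_add(1)[OF C S])
  show ?int unfolding expand by (rule set_integral_sum_finite(1)[OF CS])
  have "(LBINT y:{0<..}. ((m + y) ^ r * exp (b * y) - (m - y) ^ r * exp (- (b * y))) * h y) =
     (\<Sum>k=0..p. (LBINT y:{0<..}. C k y) + (LBINT y:{0<..}. S k y))"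
    unfolding expand set_integral_sum_finite(2)[OF CS] set_integral_add(2)[OF C S] ..
  also have "\<dots> = (\<Sum>k=0..p. 2 * m ^ (2*k) * moment_coeff (r - 2*k) *
        (real (r choose (2*k)) * hyper_2F1 ((real r - 2 * real k + 1) / 2) (\<nu> + (real r - 2 * real k + 1) / 2) (1/2) (b\<^sup>2 / \<alpha>\<^sup>2) +
         b * m * real (r choose (2*k+1)) * hyper_2F1 ((real r - 2 * real k + 1) / 2) (\<nu> + (real r - 2 * real k + 1) / 2) (3/2) (b\<^sup>2 / \<alpha>\<^sup>2)))"
  proof (rule sum.cong[OF refl], goal_cases)
    case (1 k)
    hence k: "2 * k < r" using r by simp
    hence R: "real (r - 2*k) = real r - 2 * real k" by simp
    have 1: "(LBINT y:{0<..}. C k y) = 2 * m ^ (2*k) * real (r choose (2*k)) *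
       (moment_coeff (r - 2*k) * hyper_2F1 ((real r - 2 * real k + 1) / 2) (\<nu> + (real r - 2 * real k + 1) / 2) (1/2) (b\<^sup>2 / \<alpha>\<^sup>2))"
      unfolding C_def set_integral_mult_right integral_cosh_mult_h[OF b] R ..
    have 2: "(LBINT y:{0<..}. S k y) = 2 * m ^ (2*k+1) * real (r choose (2*k+1)) *
       (b * moment_coeff (r - 2*k) * hyper_2F1 ((real r - 2 * real k + 1) / 2) (\<nu> + (real r - 2 * real k + 1) / 2) (3/2) (b\<^sup>2 / \<alpha>\<^sup>2))"
      unfolding S_def set_integral_mult_right using integral_sinh_mult_h[OF b, of "r - 2*k"] k unfolding R by simp
    show ?case unfolding 1 2 by (simp add: algebra_simps)
  qed
  finally show ?eq .
qed

lemma integral_incomplete_part: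
  fixes m b :: real
  assumes b: "\<bar>b\<bar> < \<alpha>" and m: "m \<ge> 0"
  shows "set_integrable lborel {0<..<m} (\<lambda>y. (m - y) ^ r * exp (- (b * y)) * h y)" (is ?int)
    and "(LBINT y:{0<..<m}. (m - y) ^ r * exp (- (b * y)) * h y) =
      (\<Sum>k=0..r. real (r choose k) * m ^ k * (- 1) ^ (r - k) *
         (\<Sum>j. (- b) ^ j / fact j * (moment_coeff (r - k + j) * lommel_G (\<nu> + real (r - k + j)) \<nu> (\<alpha> * m))))" (is ?eq)
proof -
  define T where "T k = (\<lambda>y. real (r choose k) * m ^ k * (- 1) ^ (r - k) * (exp (- b * y) * (y ^ (r - k) * h y)))" for k
  have expand: "(m - y) ^ r * exp (- (b * y)) * h y = (\<Sum>k=0..r. T k y)" for y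
  proof -
    have "(m - y) ^ r = (\<Sum>k=0..r. real (r choose k) * m ^ k * (- y) ^ (r - k))"
      using binomial_ring[of m "- y" r] by (simp only: atMost_atLeast0 add_uminus_conv_diff)
    thus ?thesis unfolding T_def
      by (simp add: sum_distrib_left mult_ac power_minus[of y])
  qed
  have T: "set_integrable lborel {0<..<m} (T k)" for k
    unfolding T_def using b
    by (intro set_integrable_mult_right impI set_integrable_subset[OF set_integrable_exp_power_h]) auto
  show ?int unfolding expand by (rule set_integral_sum_finite(1)[OF T])
  have T_integral: "(LBINT y:{0<..<m}. T k y) = real (r choose k) * m ^ k * (- 1) ^ (r - k) *
         (\<Sum>j. (- b) ^ j / fact j * (moment_coeff (r - k + j) * lommel_G (\<nu> + real (r - k + j)) \<nu> (\<alpha> * m)))" for k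
    unfolding T_def set_integral_mult_right
    using sums_unique[OF integral_exp_mult_h_incomplete_sums[of "- b" m "r - k"]] b m by simp
  show ?eq unfolding expand set_integral_sum_finite(2)[OF T] T_integral ..
qed

lemma integral_folded_moment:
  fixes m b :: real
  assumes b: "\<bar>b\<bar> < \<alpha>" and m: "m \<ge> 0" and r: "odd r"
  shows "(LBINT y:{0<..}. ((m + y) ^ r * exp (b * y) + \<bar>m - y\<bar> ^ r * exp (- (b * y))) * h y) =
     (LBINT y:{0<..}. ((m + y) ^ r * exp (b * y) - (m - y) ^ r * exp (- (b * y))) * h y) +
     2 * (LBINT y:{0<..<m}. (m - y) ^ r * exp (- (b * y)) * h y)"
proof -
  obtain p where p: "r = 2 * p + 1" using r by (auto elim: oddE)
  define f g where "f y = ((m + y) ^ r * exp (b * y) - (m - y) ^ r * exp (- (b * y))) * h y"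
    and "g y = (m - y) ^ r * exp (- (b * y)) * h y" for y
  have f: "set_integrable lborel {0<..} f" unfolding f_def by (rule integral_odd_part(1)[OF b p])
  have g: "set_integrable lborel {0<..<m} g" unfolding g_def by (rule integral_incomplete_part(1)[OF b m])
  have eq: "indicator {0<..} y *\<^sub>R (((m + y) ^ r * exp (b * y) + \<bar>m - y\<bar> ^ r * exp (- (b * y))) * h y) =
      indicator {0<..} y *\<^sub>R f y + 2 * (indicator {0<..<m} y *\<^sub>R g y)" for y
  proof (cases "y < m")
    case True
    thus ?thesis by (auto simp: f_def g_def algebra_simps split: split_indicator)
  next
    case False
    hence "\<bar>m - y\<bar> ^ r = - ((m - y) ^ r)"
      using power_minus_odd[OF r, of "m - y"] by simp
    thus ?thesis using False by (auto simp: f_def g_def algebra_simps split: split_indicator)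
  qed
  show ?thesis
    using f g unfolding set_lebesgue_integral_def eq set_integrable_def
    by (simp add: f_def g_def)
qed

text \<open>Folding requires each half-line to be integrable on its own; this is applied with
  \<open>c = \<mu>\<close>, \<open>b = \<beta>\<close> and with both signs reversed.\<close>

lemma set_integrable_abs_shift_moment:
  assumes b: "\<bar>b\<bar> < \<alpha>"
  shows "set_integrable lborel {0<..} (\<lambda>y. \<bar>c + y\<bar> ^ r * exp (b * y) * h y)"
proof (rule set_integrable_bound)
  show "set_integrable lborel {0<..} (\<lambda>y. \<Sum>k\<le>r. real (r choose k) * \<bar>c\<bar> ^ k * (exp (b * y) * (y ^ (r - k) * h y)))"
    by (intro set_integral_sum_finite(1) set_integrable_mult_right impI set_integrable_exp_power_h b)
  show "set_borel_measurable lborel {0<..} (\<lambda>y. \<bar>c + y\<bar> ^ r * exp (b * y) * h y)"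
    unfolding set_borel_measurable_def by measurable
  show "AE y in lborel. y \<in> {0<..} \<longrightarrow> norm (\<bar>c + y\<bar> ^ r * exp (b * y) * h y) \<le>
     norm (\<Sum>k\<le>r. real (r choose k) * \<bar>c\<bar> ^ k * (exp (b * y) * (y ^ (r - k) * h y)))"
  proof (intro AE_I2 impI)
    fix y :: real assume "y \<in> {0<..}"
    hence "\<bar>c + y\<bar> ^ r \<le> (\<bar>c\<bar> + y) ^ r" by (intro power_mono) auto
    hence "\<bar>c + y\<bar> ^ r * (exp (b * y) * h y) \<le> (\<bar>c\<bar> + y) ^ r * (exp (b * y) * h y)"
      using h_nonneg[of y] by (intro mult_right_mono) auto
    also have "\<dots> = (\<Sum>k\<le>r. real (r choose k) * \<bar>c\<bar> ^ k * (exp (b * y) * (y ^ (r - k) * h y)))"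
      unfolding binomial_ring sum_distrib_right by (intro sum.cong refl) (simp add: mult_ac)
    finally show "norm (\<bar>c + y\<bar> ^ r * exp (b * y) * h y) \<le> norm (\<Sum>k\<le>r. real (r choose k) * \<bar>c\<bar> ^ k * (exp (b * y) * (y ^ (r - k) * h y)))"
      using h_nonneg[of y] by (simp add: mult.assoc abs_mult)
  qed
qed

end

section \<open>Assembly of the absolute moment formula\<close>

theorem theorem2p3:
  fixes M :: "'a measure" and X :: "'a \<Rightarrow> real"
    and \<nu> \<alpha> \<beta> \<mu> :: real and r :: nat
  assumes "prob_space M"
    and "\<nu> > -1/2" and "\<bar>\<beta>\<bar> < \<alpha>"
    and "distributed M lborel X (\<lambda>x. ennreal (vg_density \<nu> \<alpha> \<beta> \<mu> x))"
    and "odd r"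
  shows "integrable M (\<lambda>\<omega>. \<bar>X \<omega>\<bar> ^ r)
    \<and> (\<forall>k\<in>{0..r}. summable (\<lambda>j. (-2 * sgn \<mu> * \<beta> / \<alpha>) ^ j / fact j
             * Gamma ((real r + real j - real k + 1) / 2)
             * Gamma (\<nu> + (real r + real j - real k + 1) / 2)
             * lommel_G (\<nu> + real r + real j - real k) \<nu> (\<alpha> * \<bar>\<mu>\<bar>)))
    \<and> prob_space.expectation M (\<lambda>\<omega>. \<bar>X \<omega>\<bar> ^ r) =
      2 ^ r * (1 - \<beta>\<^sup>2 / \<alpha>\<^sup>2) powr (\<nu> + 1/2) / (sqrt pi * \<alpha> ^ r * Gamma (\<nu> + 1/2))
      * ((\<Sum>k = 0..(r - 1) div 2.
            (\<alpha> * \<mu> / 2) ^ (2 * k)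
            * Gamma ((real r - 2 * real k + 1) / 2)
            * Gamma (\<nu> + (real r - 2 * real k + 1) / 2)
            * (real (r choose (2 * k))
                 * hyper_2F1 ((real r - 2 * real k + 1) / 2) (\<nu> + (real r - 2 * real k + 1) / 2)
                     (1/2) (\<beta>\<^sup>2 / \<alpha>\<^sup>2)
               + \<beta> * \<mu> * real (r choose (2 * k + 1))
                 * hyper_2F1 ((real r - 2 * real k + 1) / 2) (\<nu> + (real r - 2 * real k + 1) / 2)
                     (3/2) (\<beta>\<^sup>2 / \<alpha>\<^sup>2)))
         - (\<Sum>k = 0..r. real (r choose k) * (-1) ^ k * (\<alpha> * \<bar>\<mu>\<bar> / 2) ^ k
            * (\<Sum>j. (-2 * sgn \<mu> * \<beta> / \<alpha>) ^ j / fact j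
                 * Gamma ((real r + real j - real k + 1) / 2)
                 * Gamma (\<nu> + (real r + real j - real k + 1) / 2)
                 * lommel_G (\<nu> + real r + real j - real k) \<nu> (\<alpha> * \<bar>\<mu>\<bar>))))"
proof -
  interpret prob_space M by (rule assms(1))
  have \<alpha>: "\<alpha> > 0" using assms(3) by linarith
  interpret vg_kernel \<nu> \<alpha> by unfold_locales (use assms(2) \<alpha> in auto)
  obtain p where r: "r = 2 * p + 1" using assms(5) by (auto elim: oddE)
  define m where "m = \<bar>\<mu>\<bar>"
  \<comment> \<open>At \<open>\<mu> = 0\<close> this is \<beta> rather than
    \<open>sgn \<mu> * \<beta> = 0\<close>: the hypergeometric part still depends on
    \<open>\<beta>\<^sup>2\<close>, so \<open>b2\<close> has to hold there as well.\<close>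
  define b where "b = (if \<mu> < 0 then - \<beta> else \<beta>)"
  have b: "\<bar>b\<bar> < \<alpha>" and b2: "b\<^sup>2 = \<beta>\<^sup>2" and bm: "b * m = \<beta> * \<mu>" and m: "m \<ge> 0"
    using assms(3) by (auto simp: b_def m_def)
  have m_even: "m ^ (2 * k) = \<mu> ^ (2 * k)" for k by (simp add: m_def power_mult)
  define C where "C = (\<alpha>\<^sup>2 - \<beta>\<^sup>2) powr (\<nu> + 1/2) / (sqrt pi * (2 * \<alpha>) powr \<nu> * Gamma (\<nu> + 1/2))"
  have C: "C \<ge> 0" unfolding C_def using assms(2) by simp
  define V where "V = W * (2 / \<alpha>) ^ r"
  have V: "V > 0" using \<alpha> by (simp add: V_def W_def)
  define P where "P = 2 ^ r * (1 - \<beta>\<^sup>2 / \<alpha>\<^sup>2) powr (\<nu> + 1/2) / (sqrt pi * \<alpha> ^ r * Gamma (\<nu> + 1/2))"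
  \<comment> \<open>The exponents of \<alpha> that involve \<nu> are \<open>2 * \<nu> + 1\<close>,
    \<open>- \<nu>\<close> and \<open>- \<nu> - 1\<close>, which add up to 0; only
    \<open>\<alpha> ^ r\<close> is left in the denominator.\<close>
  have P: "C * (2 * V) = P"
  proof -
    define Q where "Q = (1 - \<beta>\<^sup>2 / \<alpha>\<^sup>2) powr (\<nu> + 1/2)"
    have "\<bar>\<beta>\<bar>\<^sup>2 < \<alpha>\<^sup>2" using assms(3) by (intro power_strict_mono) auto
    hence "1 - \<beta>\<^sup>2 / \<alpha>\<^sup>2 \<ge> 0" using \<alpha> by (simp add: field_simps)
    moreover have "\<alpha>\<^sup>2 - \<beta>\<^sup>2 = \<alpha>\<^sup>2 * (1 - \<beta>\<^sup>2 / \<alpha>\<^sup>2)" using \<alpha> by (simp add: field_simps)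
    moreover have "\<alpha>\<^sup>2 powr (\<nu> + 1/2) = \<alpha> powr (2 * \<nu> + 1)"
    proof -
      have "\<alpha>\<^sup>2 powr (\<nu> + 1/2) = (\<alpha> powr 2) powr (\<nu> + 1/2)" using \<alpha> by simp
      thus ?thesis unfolding powr_powr by (simp add: distrib_left)
    qed
    ultimately have 1: "(\<alpha>\<^sup>2 - \<beta>\<^sup>2) powr (\<nu> + 1/2) = \<alpha> powr (2 * \<nu> + 1) * Q"
      by (simp add: powr_mult Q_def)
    have 2: "(2 * \<alpha>) powr \<nu> = 2 powr \<nu> * \<alpha> powr \<nu>" using \<alpha> by (simp add: powr_mult)
    have 3: "2 * V = 2 powr \<nu> * \<alpha> powr (- \<nu> - 1) * (2 ^ r / \<alpha> ^ r)"
      by (simp add: V_def W_def powr_diff power_divide)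
    have 4: "\<alpha> powr (2 * \<nu> + 1) * \<alpha> powr (- \<nu> - 1) = \<alpha> powr \<nu>"
      by (simp add: powr_add [symmetric])
    have "C * (2 * V) = (\<alpha> powr (2 * \<nu> + 1) * \<alpha> powr (- \<nu> - 1)) / \<alpha> powr \<nu> * P"
      unfolding C_def 1 2 3 P_def Q_def [symmetric] by (simp add: mult_ac)
    also have "\<dots> = P" unfolding 4 using \<alpha> by simp
    finally show ?thesis .
  qed
  \<comment> \<open>V holds the part free of k and j. The factor \<open>(\<alpha> / 2) ^ k\<close>
    will join \<open>m ^ k\<close>, and \<open>(2 / \<alpha>) ^ j\<close> will join
    \<open>(- b) ^ j\<close>, to form the powers in the claim.\<close>
  have coeff: "moment_coeff (r - k + j) = V * (\<alpha> / 2) ^ k * (2 / \<alpha>) ^ j *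
      Gamma ((real r + real j - real k + 1) / 2) * Gamma (\<nu> + (real r + real j - real k + 1) / 2)" if "k \<le> r" for k j
  proof -
    have "(2 / \<alpha>) ^ r = (2 / \<alpha>) ^ (r - k) * (2 / \<alpha>) ^ k" using that by (simp flip: power_add)
    moreover have "(2 / \<alpha>) ^ k * (\<alpha> / 2) ^ k = 1" using \<alpha> by (simp flip: power_mult_distrib)
    ultimately have "(2 / \<alpha>) ^ (r - k) = (2 / \<alpha>) ^ r * (\<alpha> / 2) ^ k" by (simp add: mult.assoc)
    moreover have "real (r - k + j) = real r + real j - real k" using that by simp
    ultimately show ?thesis unfolding moment_coeff_def V_def power_add by (simp only: mult_ac)
  qed
  define t where "t k j = (-2 * sgn \<mu> * \<beta> / \<alpha>) ^ j / fact j
      * Gamma ((real r + real j - real k + 1) / 2) * Gamma (\<nu> + (real r + real j - real k + 1) / 2)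
      * lommel_G (\<nu> + real r + real j - real k) \<nu> (\<alpha> * \<bar>\<mu>\<bar>)" for k j
  have t: "(- b) ^ j / fact j * (moment_coeff (r - k + j) * lommel_G (\<nu> + real (r - k + j)) \<nu> (\<alpha> * m)) =
      V * (\<alpha> / 2) ^ k * t k j" if "k \<le> r" for k j
  proof (cases "\<mu> = 0")
    \<comment> \<open>The bases of the j-th powers may differ here, but both sides vanish because
      \<open>lommel_G\<close> is 0 at 0.\<close>
    case True
    thus ?thesis by (simp add: t_def m_def lommel_G_def)
  next
    case False
    hence "-2 * sgn \<mu> * \<beta> / \<alpha> = - b * (2 / \<alpha>)" by (auto simp: b_def sgn_if)
    moreover have "\<nu> + real (r - k + j) = \<nu> + real r + real j - real k" using that by simp
    ultimately show ?thesis
      unfolding coeff[OF that] t_def m_def by (simp only: power_mult_distrib) (simp add: mult_ac)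
  qed
  have t_summable: "summable (t k)" if "k \<le> r" for k
  proof -
    have "summable (\<lambda>j. V * (\<alpha> / 2) ^ k * t k j)"
      using sums_summable[OF integral_exp_mult_h_incomplete_sums[of "- b" m "r - k"]] b m
      unfolding t[OF that] by simp
    thus ?thesis using V \<alpha> by (subst (asm) summable_cmult_iff) auto
  qed
  define F where "F k = real (r choose (2 * k)) * hyper_2F1 ((real r - 2 * real k + 1) / 2) (\<nu> + (real r - 2 * real k + 1) / 2) (1/2) (\<beta>\<^sup>2 / \<alpha>\<^sup>2)
       + \<beta> * \<mu> * real (r choose (2 * k + 1)) * hyper_2F1 ((real r - 2 * real k + 1) / 2) (\<nu> + (real r - 2 * real k + 1) / 2) (3/2) (\<beta>\<^sup>2 / \<alpha>\<^sup>2)" for k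
  define S1 where "S1 = (\<Sum>k = 0..p. (\<alpha> * \<mu> / 2) ^ (2 * k) * Gamma ((real r - 2 * real k + 1) / 2) * Gamma (\<nu> + (real r - 2 * real k + 1) / 2) * F k)"
  define S2 where "S2 = (\<Sum>k = 0..r. real (r choose k) * (-1) ^ k * (\<alpha> * \<bar>\<mu>\<bar> / 2) ^ k * (\<Sum>j. t k j))"
  have part1: "(LBINT y:{0<..}. ((m + y) ^ r * exp (b * y) - (m - y) ^ r * exp (- (b * y))) * h y) = 2 * V * S1"
    unfolding integral_odd_part(2)[OF b r] S1_def sum_distrib_left b2 bm F_def [symmetric]
  proof (rule sum.cong[OF refl], goal_cases)
    case (1 k)
    hence "2 * k \<le> r" using r by simp
    from coeff[OF this, of 0] have c: "moment_coeff (r - 2 * k) = V * (\<alpha> / 2) ^ (2 * k) * Gamma ((real r - 2 * real k + 1) / 2) * Gamma (\<nu> + (real r - 2 * real k + 1) / 2)"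
      by simp
    have "(\<alpha> * \<mu> / 2) ^ (2 * k) = m ^ (2 * k) * (\<alpha> / 2) ^ (2 * k)"
      unfolding m_even by (simp add: mult.commute flip: power_mult_distrib)
    thus ?case unfolding c by (simp only: mult_ac)
  qed
  have part2: "(LBINT y:{0<..<m}. (m - y) ^ r * exp (- (b * y)) * h y) = - V * S2"
    unfolding integral_incomplete_part(2)[OF b m] S2_def sum_distrib_left
  proof (rule sum.cong[OF refl], goal_cases)
    case (1 k)
    hence k: "k \<le> r" by simp
    have 1: "(\<Sum>j. (- b) ^ j / fact j * (moment_coeff (r - k + j) * lommel_G (\<nu> + real (r - k + j)) \<nu> (\<alpha> * m))) = V * (\<alpha> / 2) ^ k * (\<Sum>j. t k j)"
      unfolding t[OF k] by (rule suminf_mult[OF t_summable[OF k]])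
    \<comment> \<open>Oddness of r turns the binomial sign into \<open>- ((- 1) ^ k)\<close>, the
      origin of the minus sign in front of the second sum.\<close>
    have "(- 1 :: real) ^ (r - k) * (- 1) ^ k = (- 1) ^ r" using k by (simp flip: power_add)
    also have "\<dots> = - 1" using assms(5) by simp
    finally have 2: "(- 1 :: real) ^ (r - k) = - ((- 1) ^ k)"
      by (cases "even k") auto
    have 3: "(\<alpha> * \<bar>\<mu>\<bar> / 2) ^ k = m ^ k * (\<alpha> / 2) ^ k"
      by (simp add: m_def mult.commute flip: power_mult_distrib)
    show ?case unfolding 1 2 3 by (simp add: mult_ac)
  qed
  \<comment> \<open>The spelling \<open>\<mu> + 1 * y\<close> is an affine substitution with slope
    1, which later carries integrability and integral back to the original variable.\<close>
  define q where "q y = vg_density \<nu> \<alpha> \<beta> \<mu> (\<mu> + 1 * y) * \<bar>\<mu> + 1 * y\<bar> ^ r" for y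
  have q1: "q y = C * (\<bar>\<mu> + y\<bar> ^ r * exp (\<beta> * y) * h y)"
    and q2: "q (- y) = C * (\<bar>- \<mu> + y\<bar> ^ r * exp (- \<beta> * y) * h y)" if "y > 0" for y
    using that abs_minus_commute[of \<mu> y] by (simp_all add: q_def vg_density_def C_def h_def mult_ac)
  have int1: "set_integrable lborel {0<..} q"
  proof -
    have "set_integrable lborel {0<..} (\<lambda>y. C * (\<bar>\<mu> + y\<bar> ^ r * exp (\<beta> * y) * h y))"
      using assms(3) by (intro set_integrable_mult_right impI set_integrable_abs_shift_moment)
    thus ?thesis by (rule set_integrable_cong[THEN iffD1, rotated -1]) (auto simp: q1)
  qed
  have int2: "set_integrable lborel {0<..} (\<lambda>y. q (- y))"
  proof -
    have "set_integrable lborel {0<..} (\<lambda>y. C * (\<bar>- \<mu> + y\<bar> ^ r * exp (- \<beta> * y) * h y))"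
      using assms(3) by (intro set_integrable_mult_right impI set_integrable_abs_shift_moment) auto
    thus ?thesis by (rule set_integrable_cong[THEN iffD1, rotated -1]) (auto simp: q2)
  qed
  have density_nonneg: "vg_density \<nu> \<alpha> \<beta> \<mu> x \<ge> 0" for x
    unfolding vg_density_def C_def [symmetric] using C by (simp add: bessel_K_nonneg)
  have "integrable lborel q" by (rule integral_lborel_fold(1)[OF int1 int2])
  hence "integrable lborel (\<lambda>x. vg_density \<nu> \<alpha> \<beta> \<mu> x * \<bar>x\<bar> ^ r)"
    unfolding q_def by (subst (asm) lborel_integrable_real_affine_iff) auto
  hence integrable: "integrable M (\<lambda>\<omega>. \<bar>X \<omega>\<bar> ^ r)"
    using distributed_integrable[OF assms(4), of "\<lambda>x. \<bar>x\<bar> ^ r"] density_nonneg by simp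
  have "expectation (\<lambda>\<omega>. \<bar>X \<omega>\<bar> ^ r) = (\<integral>x. vg_density \<nu> \<alpha> \<beta> \<mu> x * \<bar>x\<bar> ^ r \<partial>lborel)"
    using distributed_integral[OF assms(4), of "\<lambda>x. \<bar>x\<bar> ^ r"] density_nonneg by simp
  also have "\<dots> = integral\<^sup>L lborel q"
    unfolding q_def by (subst lborel_integral_real_affine[where c = 1 and t = \<mu>]) auto
  also have "\<dots> = (LBINT y:{0<..}. q y + q (- y))"
    by (rule integral_lborel_fold(2)[OF int1 int2])
  also have "\<dots> = (LBINT y:{0<..}. C * (((m + y) ^ r * exp (b * y) + \<bar>m - y\<bar> ^ r * exp (- (b * y))) * h y))"
  proof (rule set_lebesgue_integral_cong; (intro allI impI)?)
    fix y :: real assume "y \<in> {0<..}"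
    hence y: "y > 0" by simp
    \<comment> \<open>For \<open>\<mu> < 0\<close> the two halves exchange roles: the
      \<open>\<bar>m - y\<bar>\<close> term comes from \<open>q y\<close> and the
      \<open>m + y\<close> term from \<open>q (- y)\<close>.\<close>
    show "q y + q (- y) = C * (((m + y) ^ r * exp (b * y) + \<bar>m - y\<bar> ^ r * exp (- (b * y))) * h y)"
      using y unfolding q1[OF y] q2[OF y]
      by (cases "\<mu> < 0") (auto simp: m_def b_def algebra_simps abs_minus_commute)
  qed simp
  also have "\<dots> = C * (2 * V * S1 + 2 * (- V * S2))"
    unfolding set_integral_mult_right integral_folded_moment[OF b m assms(5)] part1 part2 ..
  also have "\<dots> = P * (S1 - S2)" unfolding P [symmetric] by (simp add: algebra_simps)
  finally have expectation: "expectation (\<lambda>\<omega>. \<bar>X \<omega>\<bar> ^ r) = P * (S1 - S2)" .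
  have p: "(r - 1) div 2 = p" using r by simp
  show ?thesis
    unfolding p
    using integrable t_summable expectation[unfolded P_def S1_def S2_def F_def]
    unfolding t_def by simp
qed

end
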